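(* Let $C=(F,G,H)$ be a cell with respect to $\ell_1,\dots,\ell_n$, and let $\mathcal{Z}=\{\mathbf{z}\in\mathscr{I}^n : \delta_C(\mathbf{z})=0\}$. (1) If $\mathcal{Z}$ is empty, then there is a corner $\mathbf{u}\in\{0,1\}^n$ of $\mathscr{I}^n$ such that $\delta_C(\mathbf{u})>0$, the values of $\delta_C$ at all corners adjacent to $\mathbf{u}$ are greater than $\delta_C(\mathbf{u})$, $\delta_C$ takes on its minimum value at $\mathbf{u}$, and $$\delta_C(\mathbf{t})=\delta_C(\mathbf{u})+d(\mathbf{t},\mathbf{u})\quad\text{for every }\mathbf{t}\in\mathscr{I}^n;$$ in particular $\delta_C$ is linear (i.e. given by a polynomial of degree at most $1$ in the coordinates). (2) If $\mathcal{Z}$ is nonempty, then for every $\mathbf{t}\in\mathscr{I}^n$, $\delta_C(\mathbf{t})$ is the taxi-cab distance from $\mathbf{t}$ to the set $\mathcal{Z}$, i.e. $\delta_C(\mathbf{t})=\inf_{\mathbf{z}\in\mathcal{Z}}d(\mathbf{t},\mathbf{z})$.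
   Context: Let $\Bbbk$ be a field of characteristic $p>0$, $n\ge 1$, and let $\ell_1,\dots,\ell_n\in\Bbbk[x,y]$ be pairwise relatively prime (nonzero) linear forms; put $\ell=\prod_i\ell_i$ and $\ell^{\mathbf{a}}=\prod_i\ell_i^{a_i}$ for $\mathbf{a}\in\mathbb{Z}_{\ge0}^n$. The letter $q$ denotes a power of $p$ (including $q=1$), $[q]=\{0,1,\dots,q\}$, and $\mathscr{I}=[0,1]\cap\mathbb{Z}[1/p]$. For nonzero homogeneous $F,G,H\in\Bbbk[x,y]$, a homogeneous syzygy $(\alpha,\beta,\gamma)$ (with $\alpha F+\beta G+\gamma H=0$) has degree equal to the common degree of the nonzero terms among $\alpha F,\beta G,\gamma H$; $m(F,G,H)$ is the least degree of a nontrivial homogeneous syzygy, and $\delta(F,G,H)=\deg F+\deg G+\deg H-2m(F,G,H)$. A cell (with respect to $\ell_1,\dots,\ell_n$) is a triple $C=(F,G,H)$ of nonzero homogeneous polynomials in $\Bbbk[x,y]$ such that $F$, $G$ and $H\ell$ have no common factor. The function $\delta_C:\mathscr{I}^n\to\mathbb{Q}$ is defined by $\delta_C(\mathbf{a}/q)=\frac1q\,\delta(F^q,G^q,H^q\ell^{\mathbf{a}})$ for all $q$ and $\mathbf{a}\in[q]^n$ (this is well defined because $\delta(F^p,G^p,H^p)=p\,\delta(F,G,H)$). The taxi-cab distance is $d(\mathbf{t},\mathbf{u})=\sum_{i=1}^n|t_i-u_i|$. Corners of $\mathscr{I}^n$ are the elements of $\{0,1\}^n$; two corners are adjacent if they differ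 in exactly one coordinate. *)

theory Defs
  imports "HOL-Analysis.Analysis" "HOL-Computational_Algebra.Computational_Algebra"
begin

text \<open>
  The ring of polynomials in two variables over a field is \<open>'k poly poly\<close>:
  \<open>coeff (coeff P i) j\<close> is the coefficient of the monomial \<open>y ^ i * x ^ j\<close>,
  whose total degree is \<open>i + j\<close>.
\<close>

definition homogeneous_of :: "nat \<Rightarrow> 'k::zero poly poly \<Rightarrow> bool" where
  "homogeneous_of d P \<longleftrightarrow> (\<forall>i j. coeff (coeff P i) j \<noteq> 0 \<longrightarrow> i + j = d)"

text \<open>The zero polynomial is homogeneous of every degree.\<close>

definition homogeneous :: "'k::zero poly poly \<Rightarrow> bool" where
  "homogeneous P \<longleftrightarrow> (\<exists>d. homogeneous_of d P)"

text \<open>The value at \<open>0\<close> is \<open>0\<close> by convention.\<close>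

definition total_degree :: "'k::zero poly poly \<Rightarrow> nat" where
  "total_degree P = Max (insert 0 {i + j |i j. coeff (coeff P i) j \<noteq> 0})"

definition linear_form :: "'k::zero poly poly \<Rightarrow> bool" where
  "linear_form L \<longleftrightarrow> L \<noteq> 0 \<and> homogeneous_of 1 L"

text \<open>Zero products among \<open>\<alpha> * F\<close>, \<open>\<beta> * G\<close>, \<open>\<gamma> * H\<close> impose no condition on \<open>d\<close>.\<close>

definition homogeneous_syzygy ::
  "'k::comm_ring_1 poly poly \<Rightarrow> 'k poly poly \<Rightarrow> 'k poly poly \<Rightarrow> nat \<Rightarrow>
    'k poly poly \<times> 'k poly poly \<times> 'k poly poly \<Rightarrow> bool" where
  "homogeneous_syzygy F G H d = (\<lambda>(\<alpha>, \<beta>, \<gamma>).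
     \<alpha> * F + \<beta> * G + \<gamma> * H = 0 \<and>
     homogeneous \<alpha> \<and> homogeneous \<beta> \<and> homogeneous \<gamma> \<and>
     homogeneous_of d (\<alpha> * F) \<and> homogeneous_of d (\<beta> * G) \<and> homogeneous_of d (\<gamma> * H))"

definition min_syzygy_degree ::
  "'k::comm_ring_1 poly poly \<Rightarrow> 'k poly poly \<Rightarrow> 'k poly poly \<Rightarrow> nat" where
  "min_syzygy_degree F G H =
     (LEAST d. \<exists>s. s \<noteq> (0, 0, 0) \<and> homogeneous_syzygy F G H d s)"

definition syzygy_gap ::
  "'k::comm_ring_1 poly poly \<Rightarrow> 'k poly poly \<Rightarrow> 'k poly poly \<Rightarrow> int" where
  "syzygy_gap F G H =
     int (total_degree F) + int (total_degree G) + int (total_degree H)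
       - 2 * int (min_syzygy_degree F G H)"

definition is_cell ::
  "('n::finite \<Rightarrow> 'k::field poly poly) \<Rightarrow>
    'k poly poly \<times> 'k poly poly \<times> 'k poly poly \<Rightarrow> bool" where
  "is_cell l = (\<lambda>(F, G, H).
     F \<noteq> 0 \<and> G \<noteq> 0 \<and> H \<noteq> 0 \<and> homogeneous F \<and> homogeneous G \<and> homogeneous H \<and>
     (\<forall>D. D dvd F \<and> D dvd G \<and> D dvd H * (\<Prod>i\<in>UNIV. l i) \<longrightarrow> is_unit D))"

text \<open>The interval \<open>[0, 1] \<inter> \<int>[1/p]\<close> and the cube it spans.\<close>

definition padic_unit_interval :: "nat \<Rightarrow> real set" where
  "padic_unit_interval p = {0..1} \<inter> {of_int a / real (p ^ k) |a k. True}"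

definition padic_cube :: "nat \<Rightarrow> (real ^ 'n::finite) set" where
  "padic_cube p = {t. \<forall>i. t $ i \<in> padic_unit_interval p}"

text \<open>
  The value at \<open>t\<close> is the one given by \<^emph>\<open>every\<close> presentation \<open>t = a / q\<close> with \<open>q\<close> a power
  of \<open>p\<close> and \<open>a \<in> {0..q}\<^sup>n\<close>. For homogeneous non-zero \<open>F\<close>, \<open>G\<close>, \<open>H\<close> in characteristic \<open>p\<close>
  and \<open>t\<close> in the cube, such a value exists because raising the three polynomials to
  the \<open>p\<close>-th power multiplies the syzygy gap by \<open>p\<close>. Outside the cube the value is
  unspecified.
\<close>

definition cell_gap ::
  "nat \<Rightarrow> ('n::finite \<Rightarrow> 'k::field poly poly) \<Rightarrow>
    'k poly poly \<times> 'k poly poly \<times> 'k poly poly \<Rightarrow> real ^ 'n \<Rightarrow> real" where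
  "cell_gap p l = (\<lambda>(F, G, H) t.
     (THE r. \<forall>e (a :: 'n \<Rightarrow> nat).
        (let q = p ^ e in
          (\<forall>i. a i \<le> q) \<and> t = (\<chi> i. real (a i) / real q) \<longrightarrow>
          r = 1 / real q * of_int (syzygy_gap (F ^ q) (G ^ q) (H ^ q * (\<Prod>i\<in>UNIV. l i ^ a i))))))"

definition taxicab :: "real ^ 'n::finite \<Rightarrow> real ^ 'n \<Rightarrow> real" where
  "taxicab t u = (\<Sum>i\<in>UNIV. \<bar>t $ i - u $ i\<bar>)"

definition corners :: "(real ^ 'n::finite) set" where
  "corners = {u. \<forall>i. u $ i \<in> {0, 1}}"

definition adjacent :: "real ^ 'n::finite \<Rightarrow> real ^ 'n \<Rightarrow> bool" where
  "adjacent u v \<longleftrightarrow> (\<exists>!i. u $ i \<noteq> v $ i)"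

end

theory Submission
  imports Defs "HOL-Computational_Algebra.Field_as_Ring"
begin

text \<open>
  Why the theorem is true. Fix a scale \<open>q = p ^ e\<close> and look at the gap of
  \<open>(F ^ q, G ^ q, H ^ q * \<Prod> l i ^ a i)\<close> as an integer-valued function of the lattice points \<open>a\<close> of
  the cube of side \<open>q\<close>. Everything follows from five properties of it.

  \<^item> It is nonnegative: for a syzygy whose degree is half the sum of the three degrees, rounded down,
    there are more unknown coefficients than equations (\<open>syzygy_gap_nonneg\<close>).
  \<^item> A unit step changes it by \<open>1\<close> or \<open>-1\<close> (\<open>gap_step\<close>), so it is Lipschitz for the taxi-cab distance.
  \<^item> It is homogeneous under Frobenius: at \<open>(p * q, p * a)\<close> it is \<open>p\<close> times its value at \<open>(q, a)\<close>
    (\<open>gap_frobenius\<close>). In particular \<open>\<delta>\<close> is well defined.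
  \<^item> In the interior of a segment parallel to an axis it has no positive strict local minimum
    (\<open>gap_no_positive_valley\<close>). A positive gap means that the syzygy of minimal degree is unique up
    to a unit (\<open>min_syzygy_unique\<close>). Increase in the direction of \<open>l i\<close> forces \<open>l i\<close> to divide
    the third entry of this syzygy, increase in the opposite direction forces it to divide the
    other two; both together contradict minimality.
  \<^item> If \<open>u\<close> is a corner with positive gap and larger gap at all adjacent corners, the same
    divisibilities show that the gap grows by \<open>n\<close> from \<open>u\<close> to the opposite corner
    (\<open>gap_opposite_corner\<close>).

  Now walk downhill from a point \<open>t\<close>, with steps of length \<open>1 / q\<close> each of which lowers \<open>\<delta>\<close> by
  \<open>1 / q\<close>. Either the walk reaches a zero of \<open>\<delta>\<close>, whose distance from \<open>t\<close> is then at most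
  \<open>\<delta> t\<close>; no zero is closer, by the Lipschitz property. Or the walk gets stuck at a point where \<open>\<delta>\<close>
  is positive. By the absence of valleys this is a corner \<open>u\<close>, and the homogeneity carries the
  increase along the first steps over to the adjacent corners, so the last property applies to \<open>u\<close>.
  Since every point of the cube lies on a shortest path from \<open>u\<close> to the opposite corner, along
  which \<open>\<delta>\<close> must have slope \<open>1\<close>, the function is \<open>\<delta> u\<close> plus the distance to \<open>u\<close>; it has no
  zero. So the second alternative occurs exactly when \<open>\<delta>\<close> has no zero.
\<close>

section \<open>Divisibility in the polynomial ring in two variables\<close>

definition no_common_factor :: "'a::algebraic_semidom \<Rightarrow> 'a \<Rightarrow> 'a \<Rightarrow> bool" where
  "no_common_factor a b c \<longleftrightarrow> (\<forall>d. d dvd a \<and> d dvd b \<and> d dvd c \<longrightarrow> is_unit d)"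

lemma no_common_factor_cancel_gcd:
  fixes f g h u :: "'a::semiring_gcd"
  assumes "no_common_factor f g h" "f dvd u * g" "f dvd u * h"
  shows "f dvd u"
proof -
  have "f dvd gcd (u * g) (u * h)"
    using assms by simp
  hence "f dvd u * gcd g h"
    by (simp add: gcd_mult_left)
  moreover have "coprime f (gcd g h)"
    using assms(1) unfolding no_common_factor_def coprime_def by simp
  ultimately show ?thesis
    by (simp add: coprime_dvd_mult_left_iff)
qed

lemma no_common_factor_power_factorial:
  fixes f g h :: "'a::factorial_semiring"
  assumes "no_common_factor f g h" "f \<noteq> 0"
  shows "no_common_factor (f ^ n) (g ^ n) (h ^ n)"
  unfolding no_common_factor_def
proof (intro allI impI, rule ccontr)
  fix d assume d: "d dvd f ^ n \<and> d dvd g ^ n \<and> d dvd h ^ n" "\<not> is_unit d"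
  have "d \<noteq> 0" using d(1) assms(2) by auto
  then obtain p where p: "p dvd d" "prime p"
    using prime_divisor_exists[OF _ d(2)] by auto
  have "p dvd f" "p dvd g" "p dvd h"
    using p d(1) prime_dvd_power by (meson dvd_trans)+
  hence "is_unit p" using assms(1) unfolding no_common_factor_def by blast
  thus False using p(2) by auto
qed

lemma coprime_cofactors_exist_gcd:
  fixes a b :: "'a::semiring_gcd"
  assumes "a \<noteq> 0"
  shows "\<exists>g a' b'. a = g * a' \<and> b = g * b' \<and> coprime a' b'"
proof -
  have "gcd a b \<noteq> 0" using assms by simp
  from gcd_coprime_exists[OF this] obtain a' b'
    where "a = a' * gcd a b" "b = b' * gcd a b" "coprime a' b'" by blast
  thus ?thesis
    by (intro exI[of _ "gcd a b"] exI[of _ a'] exI[of _ b'] conjI) (simp_all only: mult.commute)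
qed

text \<open>
  The ring \<open>k[x, y]\<close> is factorial for every field \<open>k\<close>, but the type classes of gcd domains
  and factorial rings include a choice of normal form for associates, and a type variable of
  class \<open>field\<close> comes without one. The field of fractions of \<open>k\<close> is a copy of \<open>k\<close> as a type of
  its own, on which the choice can be made: all nonzero elements are associated to \<open>1\<close>. The
  facts needed about divisibility are therefore proved over that copy and pulled back along
  the isomorphism \<open>fract_copy\<close>; each of them speaks of products and divisibility alone.
\<close>

instantiation fract :: (idom)
  "{unique_euclidean_ring, normalization_euclidean_semiring, normalization_semidom_multiplicative}"
begin

definition [simp]: "normalize_fract = (normalize_field :: 'a fract \<Rightarrow> _)"
definition [simp]: "unit_factor_fract = (unit_factor_field :: 'a fract \<Rightarrow> _)"
definition [simp]: "modulo_fract = (mod_field :: 'a fract \<Rightarrow> _)"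
definition [simp]: "euclidean_size_fract = (euclidean_size_field :: 'a fract \<Rightarrow> _)"
definition [simp]: "division_segment (x :: 'a fract) = 1"

instance
  by standard
    (simp_all add: dvd_field_iff field_split_simps split: if_splits)

end

instantiation fract :: (idom) euclidean_ring_gcd
begin

definition gcd_fract :: "'a fract \<Rightarrow> 'a fract \<Rightarrow> 'a fract" where
  "gcd_fract = Euclidean_Algorithm.gcd"
definition lcm_fract :: "'a fract \<Rightarrow> 'a fract \<Rightarrow> 'a fract" where
  "lcm_fract = Euclidean_Algorithm.lcm"
definition Gcd_fract :: "'a fract set \<Rightarrow> 'a fract" where
  "Gcd_fract = Euclidean_Algorithm.Gcd"
definition Lcm_fract :: "'a fract set \<Rightarrow> 'a fract" where
  "Lcm_fract = Euclidean_Algorithm.Lcm"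

instance by standard (simp_all add: gcd_fract_def lcm_fract_def Gcd_fract_def Lcm_fract_def)

end

instance fract :: (idom) field_gcd ..

definition ring_map :: "('a::comm_ring_1 \<Rightarrow> 'b::comm_ring_1) \<Rightarrow> bool" where
  "ring_map h \<longleftrightarrow> h 1 = 1 \<and> (\<forall>x y. h (x + y) = h x + h y) \<and> (\<forall>x y. h (x * y) = h x * h y)"

lemma ring_map_simps:
  assumes "ring_map h"
  shows "h 0 = 0" "h 1 = 1" "h (x + y) = h x + h y" "h (x * y) = h x * h y"
    "h (x ^ n) = h x ^ n" "h (sum f A) = (\<Sum>i\<in>A. h (f i))"
proof -
  show a: "h (x + y) = h x + h y" and m: "h (x * y) = h x * h y" and o: "h 1 = 1" for x y
    using assms by (auto simp: ring_map_def)
  have "h 0 + h 0 = h 0 + 0" using a[of 0 0] by simp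
  thus z: "h 0 = 0" by (simp only: add_left_cancel)
  show "h (x ^ n) = h x ^ n" by (induction n) (auto simp: m o)
  show "h (sum f A) = (\<Sum>i\<in>A. h (f i))"
    by (induction A rule: infinite_finite_induct) (auto simp: a z)
qed

lemma ring_map_map_poly:
  assumes "ring_map h"
  shows "ring_map (map_poly h)"
  unfolding ring_map_def
  by (auto simp: poly_eq_iff coeff_map_poly coeff_mult ring_map_simps[OF assms])

lemma bij_map_poly:
  assumes "bij h" "h 0 = 0"
  shows "bij (map_poly h)"
proof (rule bijI)
  show "inj (map_poly h)"
    using assms by (auto simp: inj_def poly_eq_iff coeff_map_poly dest: bij_is_inj[THEN injD])
  show "surj (map_poly h)"
  proof (rule surjI)
    fix q
    have "inv h 0 = 0" using assms by (metis bij_inv_eq_iff)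
    thus "map_poly h (map_poly (inv h) q) = q"
      using assms by (auto simp: poly_eq_iff coeff_map_poly surj_f_inv_f bij_is_surj)
  qed
qed

lemma ring_map_to_fract: "ring_map to_fract"
  by (auto simp: ring_map_def)

text \<open>In a field \<open>k\<close> a fraction \<open>a / b\<close> has a value in \<open>k\<close> already.\<close>

lemma bij_to_fract: "bij (to_fract :: 'a::field \<Rightarrow> 'a fract)"
proof (rule bijI)
  show "inj (to_fract :: 'a \<Rightarrow> 'a fract)" by (auto simp: inj_def)
  show "surj (to_fract :: 'a \<Rightarrow> 'a fract)"
  proof (rule surjI)
    fix x :: "'a fract"
    obtain a b where x: "x = Fract a b" "b \<noteq> 0" by (cases x) auto
    have "to_fract (a / b) = x"
      using x by (simp add: to_fract_def eq_fract)
    thus "to_fract (inv to_fract x) = x" by (metis f_inv_into_f rangeI)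
  qed
qed

definition fract_copy :: "'k::field poly poly \<Rightarrow> 'k fract poly poly" where
  "fract_copy = map_poly (map_poly to_fract)"

lemma ring_map_fract_copy: "ring_map fract_copy"
  unfolding fract_copy_def by (intro ring_map_map_poly ring_map_to_fract)

lemma bij_fract_copy: "bij fract_copy"
  unfolding fract_copy_def by (intro bij_map_poly bij_to_fract) auto

lemma fract_copy_dvd_iff: "fract_copy a dvd fract_copy b \<longleftrightarrow> a dvd b"
proof
  assume "a dvd b"
  thus "fract_copy a dvd fract_copy b"
    by (auto simp: dvd_def ring_map_simps[OF ring_map_fract_copy])
next
  assume "fract_copy a dvd fract_copy b"
  then obtain c where "fract_copy b = fract_copy a * c" by (auto simp: dvd_def)
  moreover obtain c' where "c = fract_copy c'" using bij_fract_copy by (metis bij_pointE)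
  ultimately have "fract_copy b = fract_copy (a * c')"
    by (simp add: ring_map_simps[OF ring_map_fract_copy])
  hence "b = a * c'" using bij_fract_copy by (metis bij_is_inj injD)
  thus "a dvd b" by simp
qed

lemma fract_copy_unit_iff: "is_unit (fract_copy a) \<longleftrightarrow> is_unit a"
  using fract_copy_dvd_iff[of a 1] by (simp add: ring_map_simps[OF ring_map_fract_copy])

lemma ex_fract_copy: "\<exists>b. a = fract_copy b"
  using bij_fract_copy by (metis bij_pointE)

lemma no_common_factor_fract_copy_iff:
  "no_common_factor (fract_copy f) (fract_copy g) (fract_copy h) \<longleftrightarrow> no_common_factor f g h"
proof -
  have "(\<forall>d. P d) \<longleftrightarrow> (\<forall>d. P (fract_copy d))" for P :: "'a fract poly poly \<Rightarrow> bool"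
    using ex_fract_copy by metis
  thus ?thesis
    by (simp add: no_common_factor_def fract_copy_dvd_iff fract_copy_unit_iff)
qed

lemma no_common_factor_cancel:
  fixes f g h u :: "'k::field poly poly"
  assumes "no_common_factor f g h" "f dvd u * g" "f dvd u * h"
  shows "f dvd u"
  using no_common_factor_cancel_gcd[of "fract_copy f" "fract_copy g" "fract_copy h" "fract_copy u"] assms
  by (simp add: no_common_factor_fract_copy_iff fract_copy_dvd_iff
      flip: ring_map_simps(4)[OF ring_map_fract_copy])

lemma no_common_factor_power:
  fixes f g h :: "'k::field poly poly"
  assumes "no_common_factor f g h" "f \<noteq> 0"
  shows "no_common_factor (f ^ n) (g ^ n) (h ^ n)"
proof -
  have "fract_copy f \<noteq> 0"
    using assms(2) bij_is_inj[OF bij_fract_copy] ring_map_simps(1)[OF ring_map_fract_copy]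
    by (metis injD)
  from no_common_factor_power_factorial[OF _ this, of "fract_copy g" "fract_copy h" n] assms(1)
  show ?thesis
    by (simp add: no_common_factor_fract_copy_iff flip: ring_map_simps(5)[OF ring_map_fract_copy])
qed

lemma coprime_cofactors_exist:
  fixes a b :: "'k::field poly poly"
  assumes "a \<noteq> 0"
  shows "\<exists>g a' b'. a = g * a' \<and> b = g * b' \<and> coprime a' b'"
proof -
  note hom = ring_map_simps[OF ring_map_fract_copy]
  have inj: "fract_copy x = fract_copy y \<longleftrightarrow> x = y" for x y :: "'k poly poly"
    using bij_is_inj[OF bij_fract_copy] by (auto dest: injD)
  have "fract_copy a \<noteq> 0"
    using assms inj[of a 0] hom(1) by auto
  then obtain g a' b' where *: "fract_copy a = g * a'" "fract_copy b = g * b'" "coprime a' b'"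
    using coprime_cofactors_exist_gcd by blast
  from ex_fract_copy[of g] ex_fract_copy[of a'] ex_fract_copy[of b']
  obtain G A B where GAB: "g = fract_copy G" "a' = fract_copy A" "b' = fract_copy B"
    by blast
  have "coprime A B"
  proof (rule coprimeI)
    fix d assume "d dvd A" "d dvd B"
    hence "fract_copy d dvd a'" "fract_copy d dvd b'" by (simp_all add: GAB fract_copy_dvd_iff)
    with *(3) have "is_unit (fract_copy d)" by (rule coprime_common_divisor)
    thus "is_unit d" by (simp add: fract_copy_unit_iff)
  qed
  moreover have "a = G * A" "b = G * B"
    using *(1,2) unfolding GAB by (simp_all add: inj flip: hom(4))
  ultimately show ?thesis by blast
qed

lemma coprime_dvd_mult_cancel:
  fixes a b c :: "'k::field poly poly"
  assumes "coprime a b" "a dvd c * b"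
  shows "a dvd c"
  by (rule no_common_factor_cancel[of a b b c]) (use assms in \<open>auto simp: no_common_factor_def coprime_def\<close>)

lemma prod_dvd_of_pairwise_coprime:
  fixes l :: "'i \<Rightarrow> 'k::field poly poly"
  assumes "finite I" "\<And>i. i \<in> I \<Longrightarrow> l i dvd c"
    "\<And>i j. i \<in> I \<Longrightarrow> j \<in> I \<Longrightarrow> i \<noteq> j \<Longrightarrow> coprime (l i) (l j)"
  shows "prod l I dvd c"
  using assms
proof (induction I arbitrary: c rule: finite_induct)
  case (insert i I)
  obtain c' where c': "c = l i * c'" using insert.prems(1)[of i] by (auto simp: dvd_def)
  have "prod l I dvd c'"
  proof (rule insert.IH)
    fix j assume j: "j \<in> I"
    hence "coprime (l j) (l i)" using insert.hyps(2) insert.prems(2)[of j i] by auto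
    moreover have "l j dvd c' * l i" using insert.prems(1)[of j] j c' by (simp add: mult.commute)
    ultimately show "l j dvd c'" by (rule coprime_dvd_mult_cancel)
  qed (use insert.prems(2) in auto)
  thus ?case using insert.hyps c' by simp
qed auto

section \<open>Homogeneous polynomials\<close>

text \<open>The substitution \<open>x := t\<close>, \<open>y := y t\<close>, with \<open>t\<close> as the outer variable of the result: it sends
  the monomial \<open>y ^ i x ^ j\<close> to \<open>y ^ i t ^ (i + j)\<close>, so the coefficient of \<open>t ^ n\<close> is the
  component of degree \<open>n\<close>, dehomogenised. Being an injective ring homomorphism, it turns
  statements about homogeneous polynomials into statements about monomials in \<open>t\<close> over a domain.\<close>

definition degree_grading :: "'k::comm_ring_1 poly poly \<Rightarrow> 'k poly poly" where
  "degree_grading P = poly (map_poly (map_poly (\<lambda>c. [:c:])) P) (monom [:0, 1:] 1)"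

lemma ring_map_eval:
  assumes "ring_map h"
  shows "ring_map (\<lambda>P. poly (map_poly h P) z)"
  using ring_map_map_poly[OF assms] by (auto simp: ring_map_def)

lemma ring_map_degree_grading: "ring_map degree_grading"
proof -
  have "ring_map (\<lambda>c::'a. [:c:])" by (auto simp: ring_map_def)
  from ring_map_eval[OF ring_map_map_poly[OF this]]
  show ?thesis unfolding degree_grading_def by blast
qed

lemmas degree_grading_simps = ring_map_simps[OF ring_map_degree_grading]

lemma coeff_degree_grading:
  "coeff (coeff (degree_grading P) n) i = (if i \<le> n then coeff (coeff P i) (n - i) else 0)"
proof (induction P arbitrary: n i)
  case 0
  show ?case by (simp add: degree_grading_simps(1))
next
  case (pCons p P)
  have "degree_grading (pCons p P) = map_poly (\<lambda>c. [:c:]) p + monom [:0, 1:] 1 * degree_grading P"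
    by (simp add: degree_grading_def map_poly_pCons)
  thus ?case
    by (cases n; cases i) (auto simp: coeff_monom_mult coeff_map_poly coeff_pCons pCons.IH)
qed

lemma homogeneous_of_iff_grading:
  "homogeneous_of d P \<longleftrightarrow> (\<forall>n. n \<noteq> d \<longrightarrow> coeff (degree_grading P) n = 0)"
proof
  assume *: "homogeneous_of d P"
  thus "\<forall>n. n \<noteq> d \<longrightarrow> coeff (degree_grading P) n = 0"
    unfolding homogeneous_of_def
    by (auto intro!: poly_eqI simp: coeff_degree_grading) (metis le_add_diff_inverse)
next
  assume *: "\<forall>n. n \<noteq> d \<longrightarrow> coeff (degree_grading P) n = 0"
  show "homogeneous_of d P"
    unfolding homogeneous_of_def
  proof (intro allI impI, rule ccontr)
    fix i j assume "coeff (coeff P i) j \<noteq> 0" "i + j \<noteq> d"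
    with * have "coeff (coeff (degree_grading P) (i + j)) i = 0" by simp
    thus False using \<open>coeff (coeff P i) j \<noteq> 0\<close> by (simp add: coeff_degree_grading)
  qed
qed

lemma degree_grading_eq_0_iff: "degree_grading P = 0 \<longleftrightarrow> P = 0"
proof
  assume *: "degree_grading P = 0"
  have "coeff (coeff P i) j = coeff (coeff (degree_grading P) (i + j)) i" for i j
    by (simp add: coeff_degree_grading)
  thus "P = 0" using * by (simp add: poly_eq_iff)
qed (simp add: degree_grading_simps)

lemma homogeneous_of_iff_monom:
  "homogeneous_of d P \<longleftrightarrow> (\<exists>r. degree_grading P = monom r d)"
  unfolding homogeneous_of_iff_grading
  by (auto simp: poly_eq_iff)

lemma homogeneous_of_0 [simp]: "homogeneous_of d 0"
  by (simp add: homogeneous_of_def)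

lemma homogeneous_of_1 [simp]: "homogeneous_of 0 (1 :: 'k::comm_ring_1 poly poly)"
  by (auto simp: homogeneous_of_iff_grading degree_grading_simps)

lemma homogeneous_of_add:
  fixes P Q :: "'k::comm_ring_1 poly poly"
  assumes "homogeneous_of d P" "homogeneous_of d Q"
  shows "homogeneous_of d (P + Q)"
  using assms by (simp add: homogeneous_of_iff_grading degree_grading_simps)

lemma homogeneous_of_uminus:
  fixes P :: "'k::comm_ring_1 poly poly"
  assumes "homogeneous_of d P"
  shows "homogeneous_of d (- P)"
  using assms by (simp add: homogeneous_of_def)

lemma homogeneous_of_diff:
  fixes P Q :: "'k::comm_ring_1 poly poly"
  assumes "homogeneous_of d P" "homogeneous_of d Q"
  shows "homogeneous_of d (P - Q)"
  using homogeneous_of_add[OF assms(1) homogeneous_of_uminus[OF assms(2)]] by simp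

lemma homogeneous_of_mult:
  fixes P Q :: "'k::comm_ring_1 poly poly"
  assumes "homogeneous_of a P" "homogeneous_of b Q"
  shows "homogeneous_of (a + b) (P * Q)"
  using assms by (auto simp: homogeneous_of_iff_monom degree_grading_simps mult_monom)

lemma homogeneous_of_power:
  fixes P :: "'k::comm_ring_1 poly poly"
  assumes "homogeneous_of a P"
  shows "homogeneous_of (n * a) (P ^ n)"
  using assms by (induction n) (auto intro: homogeneous_of_mult)

lemma homogeneous_of_prod:
  fixes P :: "'i \<Rightarrow> 'k::comm_ring_1 poly poly"
  assumes "\<And>i. i \<in> I \<Longrightarrow> homogeneous_of (d i) (P i)"
  shows "homogeneous_of (sum d I) (prod P I)"
  using assms
  by (induction I rule: infinite_finite_induct) (auto intro: homogeneous_of_mult)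

lemma homogeneous_of_unique:
  assumes "P \<noteq> 0" "homogeneous_of a P" "homogeneous_of b P"
  shows "a = b"
proof (rule ccontr)
  assume "a \<noteq> b"
  obtain i j where "coeff (coeff P i) j \<noteq> 0" using assms(1) by (auto simp: poly_eq_iff)
  thus False using assms(2,3) \<open>a \<noteq> b\<close> by (auto simp: homogeneous_of_def)
qed

lemma total_degree_homogeneous:
  assumes "P \<noteq> 0" "homogeneous_of d P"
  shows "total_degree P = d"
proof -
  obtain i j where "coeff (coeff P i) j \<noteq> 0" using assms(1) by (auto simp: poly_eq_iff)
  hence "{i + j |i j. coeff (coeff P i) j \<noteq> 0} = {d}"
    using assms(2) by (auto simp: homogeneous_of_def)
  thus ?thesis by (simp add: total_degree_def)
qed

text \<open>The terms of lowest degree of \<open>A\<close> and \<open>B\<close> multiply to a nonzero term of the product, and so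
  do the terms of highest degree. If the product has only one term, lowest and highest degree
  agree in \<open>A\<close>.\<close>

lemma single_term_factor:
  fixes A B :: "'a::idom poly"
  assumes "A \<noteq> 0" "B \<noteq> 0" "A * B = monom c d"
  shows "\<exists>r a. A = monom r a \<and> a \<le> d"
proof -
  have lowest: "\<exists>n. coeff P n \<noteq> 0 \<and> (\<forall>m<n. coeff P m = 0)" if "P \<noteq> 0" for P :: "'a poly"
  proof -
    have "\<exists>n. coeff P n \<noteq> 0" using that by (auto simp: poly_eq_iff)
    thus ?thesis using exists_least_iff[of "\<lambda>n. coeff P n \<noteq> 0"] by simp
  qed
  obtain a where a: "coeff A a \<noteq> 0" "\<And>n. n < a \<Longrightarrow> coeff A n = 0"
    using lowest[OF assms(1)] by blast
  obtain b where b: "coeff B b \<noteq> 0" "\<And>n. n < b \<Longrightarrow> coeff B n = 0"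
    using lowest[OF assms(2)] by blast
  have "coeff (A * B) (a + b) = (\<Sum>i\<le>a + b. coeff A i * coeff B (a + b - i))"
    by (rule coeff_mult)
  also have "\<dots> = (\<Sum>i\<in>{a}. coeff A i * coeff B (a + b - i))"
  proof (rule sum.mono_neutral_right)
    show "\<forall>i\<in>{..a + b} - {a}. coeff A i * coeff B (a + b - i) = 0"
    proof
      fix i assume "i \<in> {..a + b} - {a}"
      hence "i < a \<or> a + b - i < b" by auto
      thus "coeff A i * coeff B (a + b - i) = 0" using a(2) b(2) by auto
    qed
  qed auto
  finally have "coeff (A * B) (a + b) \<noteq> 0" using a b by simp
  hence ab: "a + b = d" by (auto simp: assms(3) split: if_splits)
  have "degree (A * B) = degree A + degree B" by (rule degree_mult_eq[OF assms(1,2)])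
  moreover have "degree (A * B) \<le> d" by (simp add: assms(3) degree_monom_le)
  moreover have "a \<le> degree A" "b \<le> degree B" using a b by (auto intro: le_degree)
  ultimately have "degree A = a" using ab by linarith
  have "A = monom (coeff A a) a"
  proof (rule poly_eqI)
    fix n
    show "coeff A n = coeff (monom (coeff A a) a) n"
      using a(2)[of n] \<open>degree A = a\<close> coeff_eq_0[of A n] by (cases n a rule: linorder_cases) auto
  qed
  moreover have "a \<le> d" using ab by simp
  ultimately show ?thesis by blast
qed

lemma homogeneous_of_factor:
  fixes A B :: "'k::idom poly poly"
  assumes "A * B \<noteq> 0" "homogeneous_of d (A * B)"
  shows "\<exists>a\<le>d. homogeneous_of a A \<and> homogeneous_of (d - a) B"
proof -
  obtain r where "degree_grading A * degree_grading B = monom r d"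
    using assms(2) by (auto simp: homogeneous_of_iff_monom degree_grading_simps)
  moreover have "degree_grading A \<noteq> 0" "degree_grading B \<noteq> 0"
    using assms(1) by (auto simp: degree_grading_eq_0_iff)
  ultimately obtain a b s t where *: "degree_grading A = monom s a" "degree_grading B = monom t b"
    by (metis single_term_factor mult.commute)
  hence "homogeneous_of a A" "homogeneous_of b B" by (auto simp: homogeneous_of_iff_monom)
  moreover from this have "a + b = d"
    using homogeneous_of_unique[OF assms(1) homogeneous_of_mult assms(2)] by blast
  ultimately show ?thesis by (intro exI[of _ a]) auto
qed

lemma homogeneous_of_cancel:
  fixes A B :: "'k::idom poly poly"
  assumes "A \<noteq> 0" "homogeneous_of a A" "homogeneous_of (a + b) (A * B)"
  shows "homogeneous_of b B"
proof (cases "B = 0")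
  case False
  then obtain a' where "homogeneous_of a' A" "homogeneous_of (a + b - a') B"
    using homogeneous_of_factor[OF _ assms(3)] assms(1) by auto
  thus ?thesis using homogeneous_of_unique[OF assms(1,2)] by auto
qed simp

lemma homogeneous_of_degree_le:
  fixes A B :: "'k::idom poly poly"
  assumes "A * B \<noteq> 0" "homogeneous_of a A" "homogeneous_of d (A * B)"
  shows "a \<le> d"
  using homogeneous_of_factor[OF assms(1,3)] homogeneous_of_unique[OF _ assms(2)] assms(1) by auto

lemma homogeneous_of_0_unit:
  fixes A :: "'k::field poly poly"
  assumes "A \<noteq> 0" "homogeneous_of 0 A"
  shows "is_unit A"
proof -
  have *: "coeff (coeff A i) j = 0" if "i \<noteq> 0 \<or> j \<noteq> 0" for i j
    using assms(2) that by (auto simp: homogeneous_of_def)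
  have "A = [:[:coeff (coeff A 0) 0:]:]"
    by (auto simp: poly_eq_iff coeff_pCons * split: nat.splits)
  moreover from this have "coeff (coeff A 0) 0 \<noteq> 0" using assms(1) by (metis pCons_0_0)
  ultimately show ?thesis by (metis is_unit_const_poly_iff dvd_field_iff zero_neq_one)
qed

lemma linear_formD:
  assumes "linear_form L"
  shows "L \<noteq> 0" "homogeneous_of 1 L"
  using assms by (auto simp: linear_form_def)

section \<open>Frobenius-linear functionals\<close>

text \<open>Linearity over the ring of \<open>p\<close>-th powers, with scalars coming out as their \<open>p\<close>-th roots. Applied to a relation
  between \<open>p\<close>-th powers, such a map returns a relation between the polynomials themselves.\<close>

definition frobenius_linear :: "nat \<Rightarrow> ('a::comm_ring_1 \<Rightarrow> 'a) \<Rightarrow> bool" where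
  "frobenius_linear p \<psi> \<longleftrightarrow>
     (\<forall>x y. \<psi> (x + y) = \<psi> x + \<psi> y) \<and> (\<forall>c x. \<psi> (c ^ p * x) = c * \<psi> x)"

text \<open>Keeps the coefficients whose exponent is \<open>i\<close> modulo \<open>p\<close>, that is, the coordinate of the basis
  element \<open>y ^ i\<close> for polynomials in \<open>y\<close> over polynomials in \<open>y ^ p\<close>, and applies \<open>\<psi>\<close> to them.
  Using it twice extends a Frobenius-linear functional from \<open>k\<close> to \<open>k[x]\<close> and to \<open>k[x, y]\<close>.\<close>

definition poly_trace :: "nat \<Rightarrow> ('a::comm_ring_1 \<Rightarrow> 'a) \<Rightarrow> nat \<Rightarrow> 'a poly \<Rightarrow> 'a poly" where
  "poly_trace p \<psi> i P = Abs_poly (\<lambda>n. \<psi> (coeff P (p * n + i)))"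

lemma frobenius_linear_0: "frobenius_linear p \<psi> \<Longrightarrow> \<psi> 0 = 0"
  unfolding frobenius_linear_def by (metis add_cancel_right_right)

lemma coeff_poly_trace:
  assumes "frobenius_linear p \<psi>" "p > 0"
  shows "coeff (poly_trace p \<psi> i P) n = \<psi> (coeff P (p * n + i))"
proof -
  have "coeff P (p * n + i) = 0" if "n > degree P" for n
  proof (rule coeff_eq_0)
    have "n \<le> p * n" using assms(2) by simp
    thus "degree P < p * n + i" using that by linarith
  qed
  thus ?thesis
    unfolding poly_trace_def
    by (subst coeff_Abs_poly[where n = "degree P"]) (auto simp: frobenius_linear_0[OF assms(1)])
qed

text \<open>By induction on the polynomial \<open>Q\<close> that is raised to the \<open>p\<close>-th power: in characteristic \<open>p\<close>
  the power of a sum is the sum of the powers, so only constants and the variable remain. The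
  bound \<open>i < p\<close> makes multiplication by \<open>y ^ p\<close> shift the kept coefficients by exactly one.\<close>

lemma frobenius_linear_poly_trace:
  fixes \<psi> :: "'a::comm_ring_1 \<Rightarrow> 'a"
  assumes lin: "frobenius_linear p \<psi>" and p: "prime p" "CHAR('a) = p" and "i < p"
  shows "frobenius_linear p (poly_trace p \<psi> i)"
proof -
  have p0: "p > 0" using p(1) prime_gt_0_nat by blast
  note co = coeff_poly_trace[OF lin p0]
  have add: "\<psi> (x + y) = \<psi> x + \<psi> y" and sc: "\<psi> (c ^ p * x) = c * \<psi> x" for x y c
    using lin by (auto simp: frobenius_linear_def)
  have tadd: "poly_trace p \<psi> i (P + Q) = poly_trace p \<psi> i P + poly_trace p \<psi> i Q" for P Q
    by (simp add: poly_eq_iff co add)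
  moreover have "poly_trace p \<psi> i (Q ^ p * P) = Q * poly_trace p \<psi> i P" for Q P
  proof (induction Q)
    case 0
    show ?case using p0 by (simp add: poly_eq_iff co frobenius_linear_0[OF lin] zero_power)
  next
    case (pCons c Q)
    have "pCons c Q = [:c:] + monom 1 1 * Q"
      by (simp add: monom_altdef)
    also have "\<dots> ^ p = [:c:] ^ p + (monom 1 1 * Q) ^ p"
      by (rule freshmans_dream) (simp_all add: p)
    also have "\<dots> = [:c ^ p:] + monom 1 p * Q ^ p"
      by (simp add: power_mult_distrib monom_power poly_const_pow)
    finally have "pCons c Q ^ p * P = smult (c ^ p) P + monom 1 p * (Q ^ p * P)"
      by (simp add: algebra_simps)
    moreover have "poly_trace p \<psi> i (smult (c ^ p) P) = smult c (poly_trace p \<psi> i P)"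
      by (simp add: poly_eq_iff co sc)
    moreover have "poly_trace p \<psi> i (monom 1 p * R) = pCons 0 (poly_trace p \<psi> i R)" for R
    proof (rule poly_eqI)
      fix n
      show "coeff (poly_trace p \<psi> i (monom 1 p * R)) n = coeff (pCons 0 (poly_trace p \<psi> i R)) n"
        using \<open>i < p\<close>
        by (cases n) (simp_all add: co coeff_monom_mult frobenius_linear_0[OF lin])
    qed
    ultimately show ?case using pCons.IH
      by (simp add: tadd)
  qed
  ultimately show ?thesis unfolding frobenius_linear_def by blast
qed

text \<open>The field is a vector space over itself through the Frobenius map, so \<open>{x}\<close> extends to a basis
  and the coordinate at \<open>x\<close> is a functional that does not vanish there.\<close>

lemma exists_frobenius_functional:
  fixes x :: "'k::field"
  assumes "CHAR('k) = p" "p > 0" "x \<noteq> 0"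
  shows "\<exists>\<psi>. frobenius_linear p \<psi> \<and> \<psi> x \<noteq> 0"
proof -
  have p: "prime CHAR('k)" using prime_CHAR_semidom[where 'a = 'k] assms by simp
  interpret V: vector_space "\<lambda>c x :: 'k. c ^ p * x"
    by standard (auto simp: algebra_simps power_mult_distrib freshmans_dream[OF p assms(1)[symmetric]])
  interpret W: vector_space "(*) :: 'k \<Rightarrow> 'k \<Rightarrow> 'k"
    by standard (auto simp: algebra_simps)
  interpret VW: vector_space_pair "\<lambda>c x :: 'k. c ^ p * x" "(*) :: 'k \<Rightarrow> 'k \<Rightarrow> 'k" ..
  have ind: "V.independent {x}" using assms(3) by simp
  define \<psi> where "\<psi> = VW.construct {x} (\<lambda>_. 1)"
  have lin: "Vector_Spaces.linear (\<lambda>c x :: 'k. c ^ p * x) (*) \<psi>"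
    unfolding \<psi>_def by (rule VW.linear_construct[OF ind])
  have "\<psi> x = 1" unfolding \<psi>_def by (simp add: VW.construct_basis[OF ind])
  moreover have "frobenius_linear p \<psi>"
    unfolding frobenius_linear_def
    using module_hom.add[OF lin[unfolded linear_iff_module_hom]]
      module_hom.scale[OF lin[unfolded linear_iff_module_hom]] by blast
  ultimately show ?thesis by auto
qed

section \<open>Syzygies of three forms\<close>

text \<open>For nonzero homogeneous \<open>F\<close>, \<open>G\<close>, \<open>H\<close> the homogeneity of \<open>a\<close>, \<open>b\<close>, \<open>c\<close> follows from that of
  the products, because factors of homogeneous polynomials are homogeneous.\<close>

definition syzygy :: "'k::field poly poly \<Rightarrow> 'k poly poly \<Rightarrow> 'k poly poly \<Rightarrow> nat \<Rightarrow>
    'k poly poly \<Rightarrow> 'k poly poly \<Rightarrow> 'k poly poly \<Rightarrow> bool" where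
  "syzygy F G H d a b c \<longleftrightarrow>
     (a \<noteq> 0 \<or> b \<noteq> 0 \<or> c \<noteq> 0) \<and> a * F + b * G + c * H = 0 \<and>
     homogeneous_of d (a * F) \<and> homogeneous_of d (b * G) \<and> homogeneous_of d (c * H)"

lemma homogeneous_left_factor:
  fixes A B :: "'k::idom poly poly"
  assumes "homogeneous_of d (A * B)" "B \<noteq> 0"
  shows "homogeneous A"
proof (cases "A = 0")
  case True
  thus ?thesis by (auto simp: homogeneous_def)
next
  case False
  hence "A * B \<noteq> 0" using assms(2) by simp
  from homogeneous_of_factor[OF this assms(1)] show ?thesis by (auto simp: homogeneous_def)
qed

text \<open>Elimination: an equation \<open>i0\<close> that is not identically zero determines one unknown \<open>j0\<close> from
  the others, which removes one equation and one unknown.\<close>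

lemma nontrivial_linear_system:
  fixes c :: "'i \<Rightarrow> 'j \<Rightarrow> 'k::field"
  assumes "finite I" "finite J" "card I < card J"
  shows "\<exists>x. (\<exists>j\<in>J. x j \<noteq> 0) \<and> (\<forall>i\<in>I. (\<Sum>j\<in>J. c i j * x j) = 0)"
  using assms
proof (induction I arbitrary: J c rule: finite_induct)
  case empty
  then obtain j where "j \<in> J" by (auto simp: card_gt_0_iff)
  thus ?case by (intro exI[of _ "\<lambda>_. 1"]) auto
next
  case (insert i0 I)
  show ?case
  proof (cases "\<forall>j\<in>J. c i0 j = 0")
    case True
    have "card I < card J" using insert by simp
    from insert.IH[OF insert.prems(1) this, of c] True show ?thesis by auto
  next
    case False
    then obtain j0 where j0: "j0 \<in> J" "c i0 j0 \<noteq> 0" by blast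
    define K where "K = J - {j0}"
    have K: "finite K" "card I < card K" "J = insert j0 K" "j0 \<notin> K"
      using insert j0 by (auto simp: K_def)
    define t where "t i j = c i j - c i j0 * c i0 j / c i0 j0" for i j
    from insert.IH[OF K(1,2), of t] obtain x
      where x: "\<exists>j\<in>K. x j \<noteq> 0" "\<forall>i\<in>I. (\<Sum>j\<in>K. t i j * x j) = 0" by blast
    define s where "s = (\<Sum>j\<in>K. c i0 j * x j)"
    define y where "y = x(j0 := - s / c i0 j0)"
    have y: "(\<Sum>j\<in>J. c i j * y j) = c i j0 * (- s / c i0 j0) + (\<Sum>j\<in>K. c i j * x j)" for i
    proof -
      have "(\<Sum>j\<in>K. c i j * y j) = (\<Sum>j\<in>K. c i j * x j)"
        by (rule sum.cong) (use K(4) in \<open>auto simp: y_def\<close>)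
      thus ?thesis using K by (simp add: y_def)
    qed
    have "(\<Sum>j\<in>J. c i j * y j) = 0" if "i \<in> insert i0 I" for i
    proof (cases "i = i0")
      case True
      thus ?thesis using j0 by (simp add: y flip: s_def)
    next
      case False
      have "0 = (\<Sum>j\<in>K. t i j * x j)" using that False x(2) by simp
      also have "\<dots> = (\<Sum>j\<in>K. c i j * x j - c i j0 / c i0 j0 * (c i0 j * x j))"
        by (simp add: t_def algebra_simps)
      also have "\<dots> = (\<Sum>j\<in>K. c i j * x j) - c i j0 / c i0 j0 * s"
        by (simp add: sum_subtractf s_def sum_distrib_left)
      finally show ?thesis by (simp add: y)
    qed
    moreover have "\<exists>j\<in>J. y j \<noteq> 0" using x(1) K by (auto simp: y_def)
    ultimately show ?thesis by blast
  qed
qed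

definition binary_form :: "nat \<Rightarrow> (nat \<Rightarrow> 'k::field) \<Rightarrow> 'k poly poly" where
  "binary_form e x = (\<Sum>n\<le>e. smult [:x n:] (monom (monom 1 (e - n)) n))"

lemma coeff_binary_form:
  "coeff (coeff (binary_form e x) i) j = (if i + j = e then x i else 0)"
proof -
  have "coeff (coeff (binary_form e x) i) j = (\<Sum>n\<le>e. if n = i then (if e - i = j then x i else 0) else 0)"
    unfolding binary_form_def coeff_sum by (rule sum.cong) auto
  thus ?thesis by (auto simp: sum.delta)
qed

lemma homogeneous_of_binary_form: "homogeneous_of e (binary_form e x)"
  by (auto simp: homogeneous_of_def coeff_binary_form)

lemma coeff_binary_form_mult:
  "coeff (coeff (binary_form e x * F) i) j =
     (\<Sum>n\<le>e. coeff (coeff (monom (monom 1 (e - n)) n * F) i) j * x n)"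
  by (simp add: binary_form_def sum_distrib_right coeff_sum mult.commute[of _ "x _"])

locale three_forms =
  fixes F G H :: "'k::field poly poly" and f g h :: nat
  assumes nonzero: "F \<noteq> 0" "G \<noteq> 0" "H \<noteq> 0"
    and degrees: "homogeneous_of f F" "homogeneous_of g G" "homogeneous_of h H"
begin

abbreviation "m \<equiv> min_syzygy_degree F G H"

lemma syzygy_iff:
  "syzygy F G H d a b c \<longleftrightarrow> (a, b, c) \<noteq> (0, 0, 0) \<and> homogeneous_syzygy F G H d (a, b, c)"
  unfolding syzygy_def homogeneous_syzygy_def
  using homogeneous_left_factor[of d a F] homogeneous_left_factor[of d b G]
    homogeneous_left_factor[of d c H] nonzero by auto

lemma min_syzygy_degree_eq: "m = (LEAST d. \<exists>a b c. syzygy F G H d a b c)"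
  unfolding min_syzygy_degree_def split_paired_Ex syzygy_iff ..

lemma min_syzygy_degree_le: "syzygy F G H d a b c \<Longrightarrow> m \<le> d"
  unfolding min_syzygy_degree_eq by (rule Least_le) blast

lemma koszul_syzygies:
  "syzygy F G H (f + g) G (- F) 0" "syzygy F G H (g + h) 0 H (- G)" "syzygy F G H (f + h) H 0 (- F)"
  using nonzero homogeneous_of_mult[OF degrees(1,2)] homogeneous_of_mult[OF degrees(2,3)]
    homogeneous_of_mult[OF degrees(1,3)]
  by (auto simp: syzygy_def mult.commute[of G F] mult.commute[of H G] mult.commute[of H F]
      intro: homogeneous_of_uminus)

lemma min_syzygy_exists: "\<exists>a b c. syzygy F G H m a b c"
  unfolding min_syzygy_degree_eq
  by (rule LeastI[of "\<lambda>d. \<exists>a b c. syzygy F G H d a b c" "f + g"]) (use koszul_syzygies in blast)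

lemma syzygy_gap_eq: "syzygy_gap F G H = int f + int g + int h - 2 * int m"
  using nonzero degrees by (simp add: syzygy_gap_def total_degree_homogeneous)

text \<open>Let \<open>d\<close> be half of \<open>f + g + h\<close>, rounded down; some syzygy has degree at most \<open>d\<close>. If one of the degrees,
  say \<open>f\<close>, exceeds \<open>d\<close>, the syzygy \<open>(0, H, - G)\<close> has degree \<open>g + h \<le> d\<close>. Otherwise, the
  coefficients of a syzygy of degree \<open>d\<close> are \<open>(d - f + 1) + (d - g + 1) + (d - h + 1)\<close> unknowns
  subject to \<open>d + 1\<close> linear equations, and \<open>f + g + h \<le> 2 * d + 1\<close>.\<close>

lemma syzygy_gap_nonneg: "syzygy_gap F G H \<ge> 0"
proof -
  have "\<exists>d a b c. 2 * d \<le> f + g + h \<and> syzygy F G H d a b c"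
  proof -
    define d where "d = (f + g + h) div 2"
    have d: "f + g + h \<le> 2 * d + 1" unfolding d_def by presburger
    consider "d < f" | "d < g" | "d < h" | "f \<le> d" "g \<le> d" "h \<le> d" by linarith
    thus ?thesis
    proof cases
      case 1
      hence "2 * (g + h) \<le> f + g + h" using d by presburger
      thus ?thesis using koszul_syzygies(2) by blast
    next
      case 2
      hence "2 * (f + h) \<le> f + g + h" using d by presburger
      thus ?thesis using koszul_syzygies(3) by blast
    next
      case 3
      hence "2 * (f + g) \<le> f + g + h" using d by presburger
      thus ?thesis using koszul_syzygies(1) by blast
    next
      case 4
      define P where "P k = (if k = 0 then F else if k = 1 then G else H)" for k :: nat
      define e where "e k = d - (if k = 0 then f else if k = 1 then g else h)" for k :: nat
      define J where "J = Sigma {0, 1, 2::nat} (\<lambda>k. {..e k})"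
      define M where "M i = (\<lambda>(k, n). coeff (coeff (monom (monom 1 (e k - n)) n * P k) i) (d - i))" for i
      have "card {..d} < card J"
        using 4 by (simp add: J_def e_def d_def)
      moreover have "finite J" by (simp add: J_def)
      ultimately obtain x where x: "\<exists>j\<in>J. x j \<noteq> 0" "\<forall>i\<in>{..d}. (\<Sum>j\<in>J. M i j * x j) = 0"
        using nontrivial_linear_system[of "{..d}" J M] by blast
      define a where "a k = binary_form (e k) (\<lambda>n. x (k, n))" for k
      have hom: "homogeneous_of d (a 0 * F)" "homogeneous_of d (a 1 * G)" "homogeneous_of d (a 2 * H)"
        using homogeneous_of_mult[OF homogeneous_of_binary_form degrees(1), of "e 0" "\<lambda>n. x (0, n)"]
          homogeneous_of_mult[OF homogeneous_of_binary_form degrees(2), of "e 1" "\<lambda>n. x (1, n)"]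
          homogeneous_of_mult[OF homogeneous_of_binary_form degrees(3), of "e 2" "\<lambda>n. x (2, n)"] 4
        by (simp_all add: a_def e_def)
      let ?S = "a 0 * F + a 1 * G + a 2 * H"
      have "coeff (coeff ?S i) j = 0" for i j
      proof (cases "i + j = d")
        case True
        hence j: "j = d - i" and i: "i \<in> {..d}" by auto
        have "0 = (\<Sum>j\<in>J. M i j * x j)" using x(2) i by simp
        also have "\<dots> = (\<Sum>k\<in>{0,1,2}. \<Sum>n\<in>{..e k}. M i (k, n) * x (k, n))"
          unfolding J_def by (subst sum.Sigma) (auto simp: case_prod_unfold)
        also have "\<dots> = coeff (coeff ?S i) j"
          by (simp add: a_def coeff_binary_form_mult M_def P_def j)
        finally show ?thesis by simp
      next
        case False
        have "homogeneous_of d ?S" by (intro homogeneous_of_add hom)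
        thus ?thesis using False by (auto simp: homogeneous_of_def)
      qed
      hence "?S = 0" by (simp add: poly_eq_iff)
      moreover obtain k n where kn: "(k, n) \<in> J" "x (k, n) \<noteq> 0" using x(1) by auto
      hence "coeff (coeff (a k) n) (e k - n) \<noteq> 0"
        by (auto simp: a_def coeff_binary_form J_def)
      hence "a k \<noteq> 0" by auto
      with kn have "a 0 \<noteq> 0 \<or> a 1 \<noteq> 0 \<or> a 2 \<noteq> 0" by (auto simp: J_def)
      ultimately have "syzygy F G H d (a 0) (a 1) (a 2)"
        using hom by (simp add: syzygy_def)
      moreover have "2 * d \<le> f + g + h" by (simp add: d_def)
      ultimately show ?thesis by blast
    qed
  qed
  then obtain d a b c where "2 * d \<le> f + g + h" "syzygy F G H d a b c" by blast
  moreover from this have "m \<le> d" by (intro min_syzygy_degree_le)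
  ultimately show ?thesis by (simp add: syzygy_gap_eq)
qed

lemma syzygy_divide:
  assumes "syzygy F G H d (u * a) (u * b) (u * c)" "homogeneous_of e u"
  shows "e \<le> d" "syzygy F G H (d - e) a b c"
proof -
  from assms(1) have u: "u \<noteq> 0" and abc: "a \<noteq> 0 \<or> b \<noteq> 0 \<or> c \<noteq> 0"
    and hom: "homogeneous_of d (u * (a * F))" "homogeneous_of d (u * (b * G))" "homogeneous_of d (u * (c * H))"
    and 0: "u * (a * F + b * G + c * H) = 0"
    by (auto simp: syzygy_def algebra_simps)
  from abc show le: "e \<le> d"
    using homogeneous_of_degree_le[OF _ assms(2) hom(1)] homogeneous_of_degree_le[OF _ assms(2) hom(2)]
      homogeneous_of_degree_le[OF _ assms(2) hom(3)] u nonzero by auto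
  have "homogeneous_of (d - e) X" if "homogeneous_of d (u * X)" for X
    using homogeneous_of_cancel[OF u assms(2), of "d - e" X] that le by simp
  thus "syzygy F G H (d - e) a b c"
    using abc 0 u hom by (simp add: syzygy_def)
qed

lemma min_syzygy_not_divisible:
  assumes "syzygy F G H m (u * a) (u * b) (u * c)" "homogeneous u"
  shows "is_unit u"
proof -
  obtain e where e: "homogeneous_of e u" using assms(2) by (auto simp: homogeneous_def)
  have "u \<noteq> 0" using assms(1) by (auto simp: syzygy_def)
  moreover have "m \<le> m - e" "e \<le> m"
    using syzygy_divide[OF assms(1) e] min_syzygy_degree_le by blast+
  hence "e = 0" by simp
  ultimately show ?thesis using homogeneous_of_0_unit e by blast
qed

text \<open>Both syzygies are orthogonal to \<open>(F, G, H)\<close>, so their cross product is proportional to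
  \<open>(F, G, H)\<close>, and it is a polynomial multiple \<open>K (F, G, H)\<close> because \<open>F\<close>, \<open>G\<close>, \<open>H\<close> have no common
  factor. The first entry times \<open>G H\<close> has degree \<open>d + d'\<close>, while \<open>F G H K\<close> has degree at least
  \<open>f + g + h\<close> unless \<open>K = 0\<close>.\<close>

lemma syzygies_cross_product_zero:
  assumes ncf: "no_common_factor F G H"
    and S: "syzygy F G H d a b c" and T: "syzygy F G H d' a' b' c'"
    and deg: "d + d' < f + g + h"
  shows "b * c' = b' * c" "c * a' = c' * a" "a * b' = a' * b"
proof -
  have eqS: "a * F + b * G + c * H = 0" and eqT: "a' * F + b' * G + c' * H = 0"
    using S T by (auto simp: syzygy_def)
  define P Q R where "P = b * c' - b' * c" "Q = c * a' - c' * a" "R = a * b' - a' * b"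
  have "P * G - Q * F = c' * (a * F + b * G + c * H) - c * (a' * F + b' * G + c' * H)"
    by (simp add: P_Q_R_def algebra_simps)
  hence PG: "P * G = Q * F" by (simp add: eqS eqT)
  have "R * F - P * H = b' * (a * F + b * G + c * H) - b * (a' * F + b' * G + c' * H)"
    by (simp add: P_Q_R_def algebra_simps)
  hence PH: "P * H = R * F" by (simp add: eqS eqT)
  have "F dvd P" by (rule no_common_factor_cancel[OF ncf]) (simp_all add: PG PH)
  then obtain K where K: "P = F * K" by (auto simp: dvd_def)
  have "P = 0"
  proof (rule ccontr)
    assume "P \<noteq> 0"
    have "homogeneous_of (d + d') ((b * G) * (c' * H) - (b' * G) * (c * H))"
      using S T homogeneous_of_mult[of d "b * G" d' "c' * H"] homogeneous_of_mult[of d "c * H" d' "b' * G"]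
      by (intro homogeneous_of_diff) (simp_all add: syzygy_def mult.commute)
    also have "(b * G) * (c' * H) - (b' * G) * (c * H) = (F * G * H) * K"
      using K by (simp add: P_Q_R_def algebra_simps)
    finally have "homogeneous_of (d + d') ((F * G * H) * K)" .
    moreover have "F * G * H * K \<noteq> 0" using \<open>P \<noteq> 0\<close> K nonzero by simp
    moreover have "homogeneous_of (f + g + h) (F * G * H)"
      by (intro homogeneous_of_mult degrees)
    ultimately have "f + g + h \<le> d + d'"
      using homogeneous_of_degree_le by blast
    thus False using deg by simp
  qed
  moreover have "Q = 0" "R = 0" using PG PH \<open>P = 0\<close> nonzero by auto
  ultimately show "b * c' = b' * c" "c * a' = c' * a" "a * b' = a' * b"
    by (simp_all add: P_Q_R_def)
qed

text \<open>If the gap is positive, two syzygies of the minimal degree have zero cross product, so they are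
  \<open>u\<close> and \<open>u'\<close> times the same triple with \<open>u\<close>, \<open>u'\<close> coprime. By minimality both factors are
  units. Only the divisors of the entries matter later, and these do not see units.\<close>

lemma min_syzygy_unique:
  assumes ncf: "no_common_factor F G H" and pos: "syzygy_gap F G H > 0"
    and S: "syzygy F G H m a b c" and T: "syzygy F G H m a' b' c'"
  shows "D dvd a \<longleftrightarrow> D dvd a'" "D dvd b \<longleftrightarrow> D dvd b'" "D dvd c \<longleftrightarrow> D dvd c'"
proof -
  have "m + m < f + g + h" using pos by (simp add: syzygy_gap_eq)
  note cross = syzygies_cross_product_zero[OF ncf S T this]
  have "\<exists>x x'. (x = a \<and> x' = a' \<or> x = b \<and> x' = b' \<or> x = c \<and> x' = c') \<and> x \<noteq> 0 \<and>
      x' * a = x * a' \<and> x' * b = x * b' \<and> x' * c = x * c'"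
    using S cross unfolding syzygy_def by (metis mult.commute)
  then obtain x x' where x: "x = a \<and> x' = a' \<or> x = b \<and> x' = b' \<or> x = c \<and> x' = c'" "x \<noteq> 0"
    and eqs: "x' * a = x * a'" "x' * b = x * b'" "x' * c = x * c'" by blast
  have x': "x' \<noteq> 0" using eqs x T by (auto simp: syzygy_def)
  have hom: "homogeneous x" "homogeneous x'"
    using x(1) S T by (auto simp: syzygy_iff homogeneous_syzygy_def)
  \<comment> \<open>The ratio of the two syzygies, in lowest terms.\<close>
  obtain w u u' where w: "x = w * u" "x' = w * u'" "coprime u u'"
    using coprime_cofactors_exist[OF x(2), of x'] by blast
  have "homogeneous u" "homogeneous u'"
    using hom w homogeneous_left_factor[of _ u w] homogeneous_left_factor[of _ u' w] x x'
    by (auto simp: homogeneous_def mult.commute)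
  have split: "\<exists>r. y = u * r \<and> y' = u' * r" if "x' * y = x * y'" for y y'
  proof -
    have *: "u' * y = u * y'" using that w x(2) by simp
    have "u dvd y"
      by (rule coprime_dvd_mult_cancel[OF w(3)]) (metis * dvd_triv_left mult.commute)
    then obtain r where "y = u * r" by (auto simp: dvd_def)
    thus ?thesis using * w x(2) by auto
  qed
  obtain r s t where rst: "a = u * r" "a' = u' * r" "b = u * s" "b' = u' * s" "c = u * t" "c' = u' * t"
    using split[OF eqs(1)] split[OF eqs(2)] split[OF eqs(3)] by blast
  have "is_unit u" "is_unit u'"
    using min_syzygy_not_divisible[of u r s t] min_syzygy_not_divisible[of u' r s t] S T rst
      \<open>homogeneous u\<close> \<open>homogeneous u'\<close> by simp_all
  thus "D dvd a \<longleftrightarrow> D dvd a'" "D dvd b \<longleftrightarrow> D dvd b'" "D dvd c \<longleftrightarrow> D dvd c'"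
    by (simp_all add: rst dvd_mult_unit_iff')
qed

end

text \<open>The trace keeps the monomials \<open>y ^ (p * n + j) x ^ (p * k + i)\<close> and sends them to
  \<open>y ^ n x ^ k\<close>.\<close>

lemma homogeneous_of_poly_trace:
  fixes X :: "'k::field poly poly"
  assumes "homogeneous_of (p * d + i + j) X" "frobenius_linear p \<phi>" "prime p" "CHAR('k) = p" "i < p"
  shows "homogeneous_of d (poly_trace p (poly_trace p \<phi> i) j X)"
proof -
  have p0: "p > 0" using assms(3) prime_gt_0_nat by blast
  have lin: "frobenius_linear p (poly_trace p \<phi> i)"
    by (rule frobenius_linear_poly_trace) fact+
  have "n + k = d" if "\<phi> (coeff (coeff X (p * n + j)) (p * k + i)) \<noteq> 0" for n k
  proof -
    have "coeff (coeff X (p * n + j)) (p * k + i) \<noteq> 0"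
      using that frobenius_linear_0[OF assms(2)] by auto
    hence "(p * n + j) + (p * k + i) = p * d + i + j"
      using assms(1) unfolding homogeneous_of_def by blast
    hence "p * (n + k) = p * d" by (simp add: algebra_simps)
    thus ?thesis using p0 by simp
  qed
  thus ?thesis
    unfolding homogeneous_of_def coeff_poly_trace[OF lin p0] coeff_poly_trace[OF assms(2) p0] by blast
qed

context three_forms
begin

lemma three_forms_power: "three_forms (F ^ n) (G ^ n) (H ^ n) (n * f) (n * g) (n * h)"
  using nonzero degrees by unfold_locales (auto intro: homogeneous_of_power)

text \<open>The \<open>p\<close>-th power of a syzygy of \<open>F\<close>, \<open>G\<close>, \<open>H\<close> is a syzygy of the \<open>p\<close>-th powers. Conversely a
  Frobenius-linear functional on \<open>k[x, y]\<close> takes a syzygy of the \<open>p\<close>-th powers to a syzygy of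
  \<open>F\<close>, \<open>G\<close>, \<open>H\<close>, of degree at most one \<open>p\<close>-th of the former. It is chosen not to kill one
  given nonzero coefficient, so that the result is not trivial.\<close>

lemma min_syzygy_degree_frobenius:
  assumes char: "CHAR('k) = p" "p > 0"
  shows "min_syzygy_degree (F ^ p) (G ^ p) (H ^ p) = p * m"
proof (rule antisym)
  interpret P: three_forms "F ^ p" "G ^ p" "H ^ p" "p * f" "p * g" "p * h"
    by (rule three_forms_power)
  have prime: "prime p" using prime_CHAR_semidom[where 'a = 'k] char by simp
  have dream: "(x + y) ^ p = x ^ p + y ^ p" for x y :: "'k poly poly"
    by (rule freshmans_dream) (simp_all add: char prime)
  show "P.m \<le> p * m"
  proof -
    obtain a b c where S: "syzygy F G H m a b c" using min_syzygy_exists by blast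
    have "a ^ p * F ^ p + b ^ p * G ^ p + c ^ p * H ^ p = (a * F + b * G + c * H) ^ p"
      by (simp add: dream power_mult_distrib)
    hence "syzygy (F ^ p) (G ^ p) (H ^ p) (p * m) (a ^ p) (b ^ p) (c ^ p)"
      using S char(2) by (auto simp: syzygy_def zero_power homogeneous_of_power simp flip: power_mult_distrib)
    thus ?thesis by (rule P.min_syzygy_degree_le)
  qed
  show "p * m \<le> P.m"
  proof -
    obtain a b c where S: "syzygy (F ^ p) (G ^ p) (H ^ p) P.m a b c"
      using P.min_syzygy_exists by blast
    then obtain x where x: "x = a \<or> x = b \<or> x = c" "x \<noteq> 0" by (auto simp: syzygy_def)
    then obtain r s where rs: "coeff (coeff x r) s \<noteq> 0" by (auto simp: poly_eq_iff)
    obtain \<phi> where \<phi>: "frobenius_linear p \<phi>" "\<phi> (coeff (coeff x r) s) \<noteq> 0"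
      using exists_frobenius_functional[OF char rs] by blast
    \<comment> \<open>The residues of the exponents of a monomial of \<open>x\<close>, which is therefore one
      of those that the trace \<open>T\<close> keeps.\<close>
    define i j where "i = s mod p" and "j = r mod p"
    have ij: "i < p" "j < p" using char by (simp_all add: i_def j_def)
    define T where "T = poly_trace p (poly_trace p \<phi> i) j"
    have lin1: "frobenius_linear p (poly_trace p \<phi> i)"
      by (rule frobenius_linear_poly_trace) (use \<phi> prime char ij in auto)
    have lin: "frobenius_linear p T"
      unfolding T_def by (rule frobenius_linear_poly_trace) (use lin1 prime char ij in auto)
    have T0: "T 0 = 0" by (rule frobenius_linear_0[OF lin])
    have Tadd: "T (y + z) = T y + T z" and Tmult: "T (y * z ^ p) = T y * z" for y z
      using lin by (auto simp: frobenius_linear_def mult.commute)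
    have "p * (r div p) + j = r" "p * (s div p) + i = s" by (simp_all add: i_def j_def)
    hence "coeff (coeff (T x) (r div p)) (s div p) = \<phi> (coeff (coeff x r) s)"
      by (simp add: T_def coeff_poly_trace[OF lin1 char(2)] coeff_poly_trace[OF \<phi>(1) char(2)])
    hence Tx: "T x \<noteq> 0" using \<phi>(2) by auto
    \<comment> \<open>All three products have degree \<open>P.m\<close>; it has the residue \<open>i +
      j\<close> modulo \<open>p\<close> because some monomial of that degree survives
      \<open>T\<close>.\<close>
    have "\<exists>d. P.m = p * d + i + j"
    proof -
      obtain D where D: "D \<noteq> 0" "homogeneous_of P.m (x * D ^ p)"
        using x S nonzero by (auto simp: syzygy_def)
      have "T (x * D ^ p) \<noteq> 0" using Tx D by (simp add: Tmult)
      then obtain u v where "coeff (coeff (T (x * D ^ p)) u) v \<noteq> 0" by (auto simp: poly_eq_iff)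
      hence "coeff (coeff (x * D ^ p) (p * u + j)) (p * v + i) \<noteq> 0"
        using frobenius_linear_0[OF \<phi>(1)]
        by (auto simp: T_def coeff_poly_trace[OF lin1 char(2)] coeff_poly_trace[OF \<phi>(1) char(2)])
      hence "(p * u + j) + (p * v + i) = P.m" using D(2) unfolding homogeneous_of_def by blast
      hence "P.m = p * (u + v) + i + j" by (simp add: algebra_simps)
      thus ?thesis by blast
    qed
    then obtain d where d: "P.m = p * d + i + j" by blast
    have homT: "homogeneous_of d (T y * D)" if "homogeneous_of P.m (y * D ^ p)" for y D
      unfolding Tmult[symmetric] unfolding T_def
      by (rule homogeneous_of_poly_trace) (use that d \<phi> prime char ij in auto)
    have "T a * F + T b * G + T c * H = T (a * F ^ p + b * G ^ p + c * H ^ p)"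
      by (simp add: Tadd Tmult)
    also have "\<dots> = 0" using S T0 by (simp add: syzygy_def)
    finally have "syzygy F G H d (T a) (T b) (T c)"
      using S x(1) Tx homT by (auto simp: syzygy_def)
    hence "m \<le> d" by (rule min_syzygy_degree_le)
    thus ?thesis unfolding d by (simp add: trans_le_add1)
  qed
qed

lemma syzygy_gap_frobenius:
  assumes "CHAR('k) = p" "p > 0"
  shows "syzygy_gap (F ^ p) (G ^ p) (H ^ p) = int p * syzygy_gap F G H"
proof -
  interpret P: three_forms "F ^ p" "G ^ p" "H ^ p" "p * f" "p * g" "p * h"
    by (rule three_forms_power)
  show ?thesis
    by (simp add: P.syzygy_gap_eq syzygy_gap_eq min_syzygy_degree_frobenius[OF assms] algebra_simps)
qed

lemma three_forms_times:
  assumes "L \<noteq> 0" "homogeneous_of k L"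
  shows "three_forms F G (H * L) f g (h + k)"
  using assms nonzero degrees by unfold_locales (auto intro: homogeneous_of_mult)

lemma syzygy_from_multiple:
  assumes "L \<noteq> 0" "syzygy F G (H * L) d a b c"
  shows "syzygy F G H d a b (L * c)"
  using assms by (auto simp: syzygy_def mult_ac)

lemma syzygy_to_multiple:
  assumes "L \<noteq> 0" "homogeneous_of k L" "syzygy F G H d a b c"
  shows "syzygy F G (H * L) (d + k) (L * a) (L * b) c"
proof -
  have hom: "homogeneous_of (d + k) (L * X)" if "homogeneous_of d X" for X
    using homogeneous_of_mult[OF assms(2) that] by (simp add: add.commute)
  have factor: "L * a * F = L * (a * F)" "L * b * G = L * (b * G)" "c * (H * L) = L * (c * H)"
    by (simp_all add: mult_ac)
  have "L * (a * F) + L * (b * G) + L * (c * H) = L * (a * F + b * G + c * H)"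
    by (simp only: distrib_left)
  thus ?thesis
    using assms(1,3) hom unfolding syzygy_def factor by simp
qed

context
  fixes L :: "'k poly poly"
  assumes linear: "linear_form L"
begin

lemmas L = linear_formD[OF linear]

interpretation K: three_forms F G "H * L" f g "h + 1"
  by (rule three_forms_times[OF L])

text \<open>Multiplying by a linear form \<open>L\<close> raises the sum of the degrees by one, and the two ways to
  pass between syzygies of \<open>(F, G, H)\<close> and of \<open>(F, G, H L)\<close> show that the minimal degree
  stays or goes up by one.\<close>

lemma syzygy_gap_times_linear:
  "syzygy_gap F G (H * L) = syzygy_gap F G H + 1 \<and> K.m = m \<or>
   syzygy_gap F G (H * L) = syzygy_gap F G H - 1 \<and> K.m = m + 1"
proof -
  obtain a b c where "syzygy F G (H * L) K.m a b c" using K.min_syzygy_exists by blast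
  from min_syzygy_degree_le[OF syzygy_from_multiple[OF L(1) this]] have "m \<le> K.m" .
  moreover obtain a b c where "syzygy F G H m a b c" using min_syzygy_exists by blast
  from K.min_syzygy_degree_le[OF syzygy_to_multiple[OF L this]] have "K.m \<le> m + 1" .
  ultimately have "K.m = m \<or> K.m = m + 1" by linarith
  thus ?thesis by (auto simp: K.syzygy_gap_eq syzygy_gap_eq)
qed

text \<open>The gap goes up only if the minimal degree stays, so a minimal syzygy of \<open>(F, G, H L)\<close> becomes
  one of \<open>(F, G, H)\<close> with last entry divisible by \<open>L\<close>. Uniqueness transfers the divisibility to
  every minimal syzygy.\<close>

lemma ascent_dvd:
  assumes "syzygy_gap F G (H * L) = syzygy_gap F G H + 1"
    and "no_common_factor F G H" "syzygy_gap F G H > 0" "syzygy F G H m a b c"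
  shows "L dvd c"
proof -
  have "K.m = m" using assms(1) syzygy_gap_times_linear by linarith
  then obtain a' b' c' where "syzygy F G H m a' b' (L * c')"
    using K.min_syzygy_exists syzygy_from_multiple[OF L(1)] by metis
  from min_syzygy_unique(3)[OF assms(2,3,4) this] show ?thesis by simp
qed

text \<open>The gap goes down only if the minimal degree goes up, so \<open>L\<close> times a minimal syzygy of
  \<open>(F, G, H)\<close>, with the factor \<open>L\<close> in the last entry moved to \<open>H\<close>, is minimal for \<open>(F, G, H L)\<close>.\<close>

lemma descent_dvd:
  assumes "syzygy_gap F G H = syzygy_gap F G (H * L) + 1"
    and "no_common_factor F G (H * L)" "syzygy_gap F G (H * L) > 0" "syzygy F G (H * L) K.m a b c"
  shows "L dvd a" "L dvd b"
proof -
  have "K.m = m + 1" using assms(1) syzygy_gap_times_linear by linarith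
  then obtain a' b' c' where "syzygy F G (H * L) K.m (L * a') (L * b') c'"
    using min_syzygy_exists syzygy_to_multiple[OF L] by metis
  from K.min_syzygy_unique(1,2)[OF assms(2,3,4) this] show "L dvd a" "L dvd b" by simp_all
qed

end

text \<open>If the gap were larger on both sides of \<open>H L\<close>, then \<open>L\<close> would divide all three entries of a
  minimal syzygy of \<open>(F, G, H L)\<close>, and cancelling it would lower the degree.\<close>

lemma no_positive_valley:
  fixes L :: "'k poly poly"
  assumes linear: "linear_form L" and ncf: "no_common_factor F G (H * L)" and pos: "syzygy_gap F G (H * L) > 0"
    and "syzygy_gap F G H = syzygy_gap F G (H * L) + 1"
  shows "syzygy_gap F G (H * L * L) = syzygy_gap F G (H * L) - 1"
proof (rule ccontr)
  note L = linear_formD[OF linear]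
  interpret K: three_forms F G "H * L" f g "h + 1" by (rule three_forms_times[OF L])
  assume "syzygy_gap F G (H * L * L) \<noteq> syzygy_gap F G (H * L) - 1"
  hence up: "syzygy_gap F G (H * L * L) = syzygy_gap F G (H * L) + 1"
    using K.syzygy_gap_times_linear[OF linear] by blast
  obtain a b c where S: "syzygy F G (H * L) K.m a b c" using K.min_syzygy_exists by blast
  have "L dvd a" "L dvd b" "L dvd c"
    using descent_dvd[OF linear assms(4) ncf pos S] K.ascent_dvd[OF linear up ncf pos S] by auto
  then obtain a' b' c' where "a = L * a'" "b = L * b'" "c = L * c'" by (auto simp: dvd_def)
  with S have "is_unit L"
    using K.min_syzygy_not_divisible L(2) unfolding homogeneous_def by blast
  then obtain M where M: "L * M = 1" by (metis dvd_def)
  from homogeneous_of_degree_le[of L M 1 0] M L(2) show False by simp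
qed

text \<open>Cancelling \<open>A\<close> in \<open>(A a') F + (A b') G + (B c') (H A) = 0\<close> lowers the degree by \<open>\<alpha>\<close> and leaves
  the syzygy \<open>(a', b', c')\<close> of \<open>(F, G, H B)\<close>.\<close>

lemma opposite_corner_gap:
  assumes A: "A \<noteq> 0" "homogeneous_of \<alpha> A" and B: "B \<noteq> 0" "homogeneous_of \<beta> B"
    and S: "syzygy F G (H * A) (min_syzygy_degree F G (H * A)) a b c"
    and dvd: "A dvd a" "A dvd b" "B dvd c"
  shows "syzygy_gap F G (H * B) \<ge> syzygy_gap F G (H * A) + int (\<alpha> + \<beta>)"
proof -
  interpret P: three_forms F G "H * A" f g "h + \<alpha>" by (rule three_forms_times[OF A])
  interpret Q: three_forms F G "H * B" f g "h + \<beta>" by (rule three_forms_times[OF B])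
  obtain a' b' c' where abc: "a = A * a'" "b = A * b'" "c = B * c'"
    using dvd by (auto simp: dvd_def)
  from syzygy_from_multiple[OF A(1) S] have "syzygy F G H P.m (A * a') (A * b') (A * (B * c'))"
    by (simp add: abc)
  from syzygy_divide[OF this A(2)] have le: "\<alpha> \<le> P.m" and "syzygy F G H (P.m - \<alpha>) a' b' (B * c')"
    by simp_all
  hence "syzygy F G (H * B) (P.m - \<alpha>) a' b' c'"
    using B(1) by (auto simp: syzygy_def mult_ac)
  from Q.min_syzygy_degree_le[OF this] le have "Q.m + \<alpha> \<le> P.m" by simp
  thus ?thesis by (simp add: P.syzygy_gap_eq Q.syzygy_gap_eq)
qed

end

section \<open>Cells\<close>

locale cell =
  fixes p :: nat and F G H :: "'k::field poly poly" and f g h :: nat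
    and l :: "'n::finite \<Rightarrow> 'k poly poly"
  assumes char: "CHAR('k) = p" "p > 0"
    and forms: "three_forms F G H f g h"
    and linear: "\<And>i. linear_form (l i)"
    and coprime: "\<And>i j. i \<noteq> j \<Longrightarrow> coprime (l i) (l j)"
    and no_common: "no_common_factor F G (H * (\<Prod>i\<in>UNIV. l i))"
begin

text \<open>The gap function of the cell without its normalizing factor \<open>1 / p ^ e\<close>, on the integral points
  of the cube of side \<open>p ^ e\<close>.\<close>

definition gap :: "nat \<Rightarrow> ('n \<Rightarrow> nat) \<Rightarrow> int" where
  "gap e a = syzygy_gap (F ^ p ^ e) (G ^ p ^ e) (H ^ p ^ e * (\<Prod>i\<in>UNIV. l i ^ a i))"

lemma linear_power: "l i ^ k \<noteq> 0" "homogeneous_of k (l i ^ k)"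
  using linear_formD[OF linear[of i]] homogeneous_of_power[of 1 "l i" k] by auto

lemma product_power: "(\<Prod>i\<in>I. l i ^ a i) \<noteq> 0" "homogeneous_of (\<Sum>i\<in>I. a i) (\<Prod>i\<in>I. l i ^ a i)"
  using linear_power homogeneous_of_prod[of I a "\<lambda>i. l i ^ a i"] by auto

lemma lattice_forms:
  "three_forms (F ^ p ^ e) (G ^ p ^ e) (H ^ p ^ e * (\<Prod>i\<in>UNIV. l i ^ a i))
     (p ^ e * f) (p ^ e * g) (p ^ e * h + (\<Sum>i\<in>UNIV. a i))"
  by (rule three_forms.three_forms_times[OF three_forms.three_forms_power[OF forms] product_power])

lemma gap_nonneg: "gap e a \<ge> 0"
  unfolding gap_def by (rule three_forms.syzygy_gap_nonneg[OF lattice_forms])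

lemma gap_frobenius: "gap (Suc e) (\<lambda>i. p * a i) = int p * gap e a"
proof -
  have "H ^ p ^ Suc e * (\<Prod>i\<in>UNIV. l i ^ (p * a i)) = (H ^ p ^ e * (\<Prod>i\<in>UNIV. l i ^ a i)) ^ p"
    by (simp add: power_mult_distrib prod_power_distrib mult.commute[of p] flip: power_mult)
  thus ?thesis
    using three_forms.syzygy_gap_frobenius[OF lattice_forms char, of e a]
    by (simp add: gap_def mult.commute[of p] power_mult)
qed

lemma product_step:
  "(\<Prod>j\<in>UNIV. l j ^ (a(i := a i + k)) j) = (\<Prod>j\<in>UNIV. l j ^ a j) * l i ^ k"
proof -
  have "(\<Prod>j\<in>UNIV. l j ^ (a(i := a i + k)) j) = l i ^ (a i + k) * (\<Prod>j\<in>UNIV - {i}. l j ^ a j)"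
    by (subst prod.remove[of _ i]) (auto intro!: prod.cong)
  also have "\<dots> = (\<Prod>j\<in>UNIV. l j ^ a j) * l i ^ k"
    by (subst (2) prod.remove[of _ i]) (auto simp: power_add mult_ac)
  finally show ?thesis .
qed

lemma gap_step: "gap e (a(i := a i + 1)) = gap e a + 1 \<or> gap e (a(i := a i + 1)) = gap e a - 1"
  using three_forms.syzygy_gap_times_linear[OF lattice_forms linear, of e a i] product_step[of a i 1]
  by (auto simp: gap_def mult.assoc)

lemma no_common_factor_lattice:
  assumes "\<And>i. a i \<le> p ^ e"
  shows "no_common_factor (F ^ p ^ e) (G ^ p ^ e) (H ^ p ^ e * (\<Prod>i\<in>UNIV. l i ^ a i))"
proof -
  have "F \<noteq> 0" using forms by (simp add: three_forms_def)
  from no_common_factor_power[OF no_common this]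
  have *: "no_common_factor (F ^ p ^ e) (G ^ p ^ e) (H ^ p ^ e * (\<Prod>i\<in>UNIV. l i ^ p ^ e))"
    by (simp add: power_mult_distrib prod_power_distrib)
  have "H ^ p ^ e * (\<Prod>i\<in>UNIV. l i ^ a i) dvd H ^ p ^ e * (\<Prod>i\<in>UNIV. l i ^ p ^ e)"
    by (intro mult_dvd_mono dvd_refl prod_dvd_prod le_imp_power_dvd assms)
  thus ?thesis using * unfolding no_common_factor_def by (meson dvd_trans)
qed

lemma gap_no_positive_valley:
  assumes le: "\<And>j. (a(i := a i + 1)) j \<le> p ^ e" and pos: "gap e (a(i := a i + 1)) > 0"
    and down: "gap e a = gap e (a(i := a i + 1)) + 1"
  shows "gap e (a(i := a i + 2)) = gap e (a(i := a i + 1)) - 1"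
  using three_forms.no_positive_valley[OF lattice_forms linear, of e a i]
    no_common_factor_lattice[of "a(i := a i + 1)", OF le] assms(2,3) product_step[of a i 1] product_step[of a i 2]
  by (simp add: gap_def mult.assoc power2_eq_square)

text \<open>A minimal syzygy at the corner \<open>u\<close> has its first two entries divisible by the \<open>l i\<close> that occur
  at \<open>u\<close>, and its last entry divisible by the others. The forms being pairwise coprime, their
  products divide these entries too, and \<open>opposite_corner_gap\<close> applies.\<close>

lemma gap_opposite_corner:
  assumes u: "\<And>i. u i \<in> {0, 1}" and pos: "gap 0 u > 0"
    and up: "\<And>i. gap 0 (u(i := 1 - u i)) = gap 0 u + 1"
  shows "gap 0 (\<lambda>i. 1 - u i) \<ge> gap 0 u + int CARD('n)"
proof -
  define I where "I = {i. u i = 1}"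
  define A where "A = (\<Prod>i\<in>UNIV. l i ^ u i)"
  define B where "B = (\<Prod>i\<in>UNIV. l i ^ (1 - u i))"
  have u_eq: "u i = (if i \<in> I then 1 else 0)" for i using u[of i] by (auto simp: I_def)
  have "A = (\<Prod>i\<in>UNIV. if i \<in> I then l i else 1)"
    unfolding A_def by (intro prod.cong refl) (simp add: u_eq)
  hence A: "A = prod l I" by (simp add: prod.If_cases)
  have "B = (\<Prod>i\<in>UNIV. if i \<in> - I then l i else 1)"
    unfolding B_def by (intro prod.cong refl) (simp add: u_eq)
  hence B: "B = prod l (- I)" by (simp add: prod.If_cases Compl_eq)
  have gap_eq: "gap 0 v = syzygy_gap F G (H * (\<Prod>i\<in>UNIV. l i ^ v i))" for v
    by (simp add: gap_def)
  have ncf: "no_common_factor F G (H * A)"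
    using no_common_factor_lattice[of u 0] by (simp add: A_def u_eq)
  interpret P: three_forms F G "H * A" f g "h + sum u UNIV"
    using lattice_forms[of 0 u] by (simp add: A_def)
  obtain a b c where S: "syzygy F G (H * A) P.m a b c" using P.min_syzygy_exists by blast
  have "l i dvd a \<and> l i dvd b" if "i \<in> I" for i
  proof -
    define v where "v = u(i := 0)"
    have uv: "u = v(i := v i + 1)" "v = u(i := 1 - u i)" using that by (auto simp: v_def I_def)
    have Av: "A = (\<Prod>i\<in>UNIV. l i ^ v i) * l i"
      unfolding A_def uv(1) product_step by simp
    interpret V: three_forms F G "H * (\<Prod>i\<in>UNIV. l i ^ v i)" f g "h + sum v UNIV"
      using lattice_forms[of 0 v] by simp
    show ?thesis
      using V.descent_dvd[OF linear, of i a b c] up[of i, folded uv(2)] ncf pos S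
      by (simp add: gap_eq Av mult.assoc flip: A_def)
  qed
  moreover have "l i dvd c" if "i \<in> - I" for i
  proof -
    have "u i = 0" using that by (simp add: u_eq)
    hence uv: "u(i := 1 - u i) = u(i := u i + 1)" by simp
    have "gap 0 (u(i := 1 - u i)) = syzygy_gap F G (H * A * l i)"
      unfolding gap_eq uv product_step A_def by (simp add: mult.assoc)
    thus ?thesis
      using P.ascent_dvd[OF linear _ ncf _ S] up[of i] pos by (simp add: gap_eq A_def)
  qed
  ultimately have "A dvd a" "A dvd b" "B dvd c"
    unfolding A B by (auto intro!: prod_dvd_of_pairwise_coprime coprime)
  from three_forms.opposite_corner_gap[OF forms _ _ _ _ S this, of "sum u UNIV" "sum (\<lambda>i. 1 - u i) UNIV"]
  have "gap 0 (\<lambda>i. 1 - u i) \<ge> gap 0 u + int (sum u UNIV + sum (\<lambda>i. 1 - u i) UNIV)"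
    using product_power[of u UNIV] product_power[of "\<lambda>i. 1 - u i" UNIV] by (simp add: gap_eq A_def B_def)
  also have "sum u UNIV + sum (\<lambda>i. 1 - u i) UNIV = (\<Sum>i\<in>(UNIV :: 'n set). 1)"
    unfolding sum.distrib[symmetric] by (intro sum.cong refl) (simp add: u_eq)
  finally show ?thesis by simp
qed

end

section \<open>Descent on the lattice\<close>

definition lattice_dist :: "('n::finite \<Rightarrow> nat) \<Rightarrow> ('n \<Rightarrow> nat) \<Rightarrow> int" where
  "lattice_dist a b = (\<Sum>i\<in>UNIV. \<bar>int (a i) - int (b i)\<bar>)"

lemma lattice_dist_update:
  "lattice_dist (a(i := x)) b = lattice_dist a b - \<bar>int (a i) - int (b i)\<bar> + \<bar>int x - int (b i)\<bar>"
proof -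
  have "lattice_dist c b = \<bar>int (c i) - int (b i)\<bar> + (\<Sum>j\<in>UNIV - {i}. \<bar>int (c j) - int (b j)\<bar>)" for c
    unfolding lattice_dist_def by (rule sum.remove) auto
  from this[of "a(i := x)"] this[of a] show ?thesis
    by (simp add: sum.cong[of "UNIV - {i}" "UNIV - {i}" "\<lambda>j. \<bar>int ((a(i := x)) j) - int (b j)\<bar>" "\<lambda>j. \<bar>int (a j) - int (b j)\<bar>"])
qed

lemma lattice_dist_nonneg: "lattice_dist a b \<ge> 0"
  unfolding lattice_dist_def by (rule sum_nonneg) auto

lemma lattice_dist_self [simp]: "lattice_dist a a = 0"
  by (simp add: lattice_dist_def)

lemma lattice_dist_commute: "lattice_dist a b = lattice_dist b a"
  by (simp add: lattice_dist_def abs_minus_commute)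

lemma lattice_dist_triangle: "lattice_dist a c \<le> lattice_dist a b + lattice_dist b c"
  unfolding lattice_dist_def sum.distrib[symmetric] by (rule sum_mono) auto

context cell
begin

lemma gap_adjacent:
  assumes "x = a i + 1 \<or> a i = x + 1"
  shows "gap e (a(i := x)) = gap e a + 1 \<or> gap e (a(i := x)) = gap e a - 1"
  using assms
proof
  assume "x = a i + 1"
  thus ?thesis using gap_step[of e a i] by simp
next
  assume x: "a i = x + 1"
  hence "(a(i := x))(i := (a(i := x)) i + 1) = a" by auto
  with gap_step[of e "a(i := x)" i] show ?thesis by auto
qed

text \<open>Along a shortest lattice path from \<open>a\<close> to \<open>b\<close> every step changes the gap by one.\<close>

lemma gap_lipschitz: "gap e a - gap e b \<le> lattice_dist a b"
proof (induction "nat (lattice_dist a b)" arbitrary: a rule: less_induct)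
  case less
  show ?case
  proof (cases "a = b")
    case False
    then obtain i where i: "a i \<noteq> b i" by auto
    define x where "x = (if a i < b i then a i + 1 else a i - 1)"
    have x: "x = a i + 1 \<or> a i = x + 1" using i by (auto simp: x_def)
    have d: "lattice_dist (a(i := x)) b = lattice_dist a b - 1"
      using i by (auto simp: lattice_dist_update x_def)
    hence "gap e (a(i := x)) - gap e b \<le> lattice_dist (a(i := x)) b"
      using lattice_dist_nonneg[of "a(i := x)" b] by (intro less) auto
    thus ?thesis using d gap_adjacent[of x a i e, OF x] by auto
  qed simp
qed

lemma gap_scale: "gap (k + e) (\<lambda>i. p ^ k * a i) = int (p ^ k) * gap e a"
proof (induction k)
  case (Suc k)
  have "gap (Suc k + e) (\<lambda>i. p ^ Suc k * a i) = gap (Suc (k + e)) (\<lambda>i. p * (p ^ k * a i))"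
    by (simp add: mult.assoc)
  thus ?case unfolding gap_frobenius Suc.IH by simp
qed simp

lemma gap_corner: "gap e (\<lambda>i. p ^ e * u i) = int (p ^ e) * gap 0 u"
  using gap_scale[of e 0 u] by simp

text \<open>The map \<open>u(i := 1 - u i)\<close> passes to an adjacent corner. At a corner with this property the cell
  has no zero at all, and the gap is determined everywhere by its value there.\<close>

definition minimal_corner :: "('n \<Rightarrow> nat) \<Rightarrow> bool" where
  "minimal_corner u \<longleftrightarrow> (\<forall>i. u i \<in> {0, 1}) \<and> gap 0 u > 0 \<and>
     (\<forall>i. gap 0 (u(i := 1 - u i)) = gap 0 u + 1)"

text \<open>A point with positive gap from which no step inside the cube descends cannot be interior in
  any coordinate, for that would be a valley. So it is \<open>p ^ e\<close> times a corner \<open>u\<close>, and the gap at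
  it is \<open>p ^ e\<close> times that at \<open>u\<close>. The neighbours of \<open>u\<close> at scale \<open>1\<close> cannot be lower
  either: the gap would have to fall by \<open>p ^ e\<close> along an edge of length \<open>p ^ e\<close> whose first step
  goes up.\<close>

lemma stuck_point_corner:
  assumes box: "\<And>i. a i \<le> p ^ e" and pos: "gap e a > 0"
    and stuck: "\<And>i x. x \<le> p ^ e \<Longrightarrow> x = a i + 1 \<or> a i = x + 1 \<Longrightarrow> gap e (a(i := x)) = gap e a + 1"
  shows "\<exists>u. minimal_corner u"
proof -
  define q where "q = p ^ e"
  have q0: "q > 0" using char by (simp add: q_def)
  have ends: "a i = 0 \<or> a i = q" for i
  proof (rule ccontr)
    assume "\<not> ?thesis"
    hence i: "0 < a i" "a i < q" using box[of i] by (auto simp: q_def)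
    define b where "b = a(i := a i - 1)"
    have b1: "b(i := b i + 1) = a" and b2: "b(i := b i + 2) = a(i := a i + 1)"
      using i by (auto simp: b_def)
    have "gap e b = gap e a + 1" unfolding b_def by (rule stuck) (use i in \<open>auto simp: q_def\<close>)
    hence "gap e (a(i := a i + 1)) = gap e a - 1"
      using gap_no_positive_valley[of b i e] box pos unfolding b1 b2 by blast
    moreover have "gap e (a(i := a i + 1)) = gap e a + 1" by (rule stuck) (use i in \<open>auto simp: q_def\<close>)
    ultimately show False by simp
  qed
  define u where "u i = (if a i = 0 then 0 else 1 :: nat)" for i
  have u: "u i \<in> {0, 1}" for i by (simp add: u_def)
  have a: "a = (\<lambda>i. q * u i)"
  proof
    fix i show "a i = q * u i" using ends[of i] by (auto simp: u_def)
  qed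
  have gap_a: "gap e a = int q * gap 0 u" unfolding a q_def by (rule gap_corner)
  have "gap 0 (u(i := 1 - u i)) = gap 0 u + 1" for i
  proof (rule ccontr)
    assume "gap 0 (u(i := 1 - u i)) \<noteq> gap 0 u + 1"
    hence down: "gap 0 (u(i := 1 - u i)) = gap 0 u - 1"
      using gap_adjacent[of "1 - u i" u i 0] u[of i] by auto
    \<comment> \<open>The adjacent corner at scale \<open>q\<close>. One step from \<open>a\<close> towards it
      the gap is \<open>gap e a + 1\<close>, and the \<open>q - 1\<close> steps that remain
      cannot bring it down to \<open>gap e a - q\<close>.\<close>
    define v where "v = (\<lambda>j. q * (u(i := 1 - u i)) j)"
    have "gap e v = int q * (gap 0 u - 1)"
      unfolding v_def q_def gap_corner down by simp
    hence gap_v: "gap e v = gap e a - int q" by (simp add: gap_a algebra_simps)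
    define x where "x = (if a i = 0 then 1 else q - 1)"
    have "gap e (a(i := x)) = gap e a + 1"
      by (rule stuck) (use ends[of i] q0 in \<open>auto simp: x_def q_def\<close>)
    moreover have "lattice_dist (a(i := x)) v = int q - 1"
    proof -
      have "a(i := x) = v(i := x)" by (auto simp: a v_def fun_eq_iff)
      hence "lattice_dist (a(i := x)) v = \<bar>int x - int (v i)\<bar>"
        by (simp add: lattice_dist_update)
      also have "\<dots> = int q - 1"
        using u[of i] q0 by (auto simp: x_def v_def a of_nat_diff)
      finally show ?thesis .
    qed
    ultimately show False using gap_lipschitz[of e "a(i := x)" v] gap_v by simp
  qed
  moreover have "gap 0 u > 0" using pos gap_a q0 by (simp add: zero_less_mult_iff)
  ultimately show ?thesis using u by (auto simp: minimal_corner_def)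
qed

text \<open>From a positive value one can go down by one per step until the gap vanishes, unless the path
  gets stuck.\<close>

lemma descent:
  assumes "\<And>i. a i \<le> p ^ e"
  shows "(\<exists>z. (\<forall>i. z i \<le> p ^ e) \<and> gap e z = 0 \<and> lattice_dist a z \<le> gap e a) \<or> (\<exists>u. minimal_corner u)"
  using assms
proof (induction "nat (gap e a)" arbitrary: a rule: less_induct)
  case less
  show ?case
  proof (cases "gap e a = 0")
    case True
    thus ?thesis using less.prems by (intro disjI1 exI[of _ a]) auto
  next
    case False
    hence pos: "gap e a > 0" using gap_nonneg[of e a] by simp
    show ?thesis
    proof (cases "\<exists>i x. x \<le> p ^ e \<and> (x = a i + 1 \<or> a i = x + 1) \<and> gap e (a(i := x)) \<noteq> gap e a + 1")
      case True
      then obtain i x where x: "x \<le> p ^ e" "x = a i + 1 \<or> a i = x + 1"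
        and "gap e (a(i := x)) \<noteq> gap e a + 1" by blast
      hence down: "gap e (a(i := x)) = gap e a - 1" using gap_adjacent[of x a i e, OF x(2)] by blast
      have "lattice_dist (a(i := x)) a = 1" using x(2) by (auto simp: lattice_dist_update)
      hence "lattice_dist a z \<le> 1 + lattice_dist (a(i := x)) z" for z
        using lattice_dist_triangle[of a z "a(i := x)"] by (simp add: lattice_dist_commute)
      moreover have "(\<exists>z. (\<forall>i. z i \<le> p ^ e) \<and> gap e z = 0 \<and> lattice_dist (a(i := x)) z \<le> gap e (a(i := x)))
          \<or> (\<exists>u. minimal_corner u)"
        using down pos x less.prems by (intro less.hyps) auto
      ultimately show ?thesis using down by (smt (verit))
    next
      case False
      thus ?thesis using stuck_point_corner[of a e] less.prems pos by blast
    qed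
  qed
qed

text \<open>The gap grows by the full length \<open>p ^ e * n\<close> from \<open>u\<close> to the opposite corner. Every point \<open>a\<close> of
  the cube lies on a shortest path between the two, so the Lipschitz bounds on both parts of the
  path must be equalities.\<close>

lemma gap_from_minimal_corner:
  assumes "minimal_corner u" and box: "\<And>i. a i \<le> p ^ e"
  shows "gap e a = int (p ^ e) * gap 0 u + lattice_dist a (\<lambda>i. p ^ e * u i)"
proof (rule antisym)
  have u: "u i \<in> {0, 1}" for i using assms(1) by (simp add: minimal_corner_def)
  show "gap e a \<le> int (p ^ e) * gap 0 u + lattice_dist a (\<lambda>i. p ^ e * u i)"
    using gap_lipschitz[of e a "\<lambda>i. p ^ e * u i"] by (simp add: gap_corner)
  have "gap 0 (\<lambda>i. 1 - u i) \<ge> gap 0 u + int CARD('n)"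
    using assms(1) by (intro gap_opposite_corner) (auto simp: minimal_corner_def)
  hence "int (p ^ e) * (gap 0 u + int CARD('n)) \<le> gap e (\<lambda>i. p ^ e * (1 - u i))"
    unfolding gap_corner by (intro mult_left_mono) auto
  also have "\<dots> \<le> gap e a + lattice_dist a (\<lambda>i. p ^ e * (1 - u i))"
    using gap_lipschitz[of e "\<lambda>i. p ^ e * (1 - u i)" a] by (simp add: lattice_dist_commute)
  finally have "int (p ^ e) * (gap 0 u + int CARD('n)) \<le> gap e a + lattice_dist a (\<lambda>i. p ^ e * (1 - u i))" .
  moreover have "lattice_dist a (\<lambda>i. p ^ e * u i) + lattice_dist a (\<lambda>i. p ^ e * (1 - u i)) =
      int (p ^ e) * int CARD('n)"
  proof -
    have "\<bar>int (a i) - int (p ^ e * u i)\<bar> + \<bar>int (a i) - int (p ^ e * (1 - u i))\<bar> = int (p ^ e)" for i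
    proof -
      have "int (a i) \<le> int (p ^ e)" using box[of i] by (simp only: of_nat_le_iff)
      thus ?thesis using u[of i] by auto
    qed
    thus ?thesis unfolding lattice_dist_def sum.distrib[symmetric] by simp
  qed
  ultimately show "int (p ^ e) * gap 0 u + lattice_dist a (\<lambda>i. p ^ e * u i) \<le> gap e a"
    by (simp add: algebra_simps)
qed

section \<open>The gap function on the cube\<close>

definition point :: "nat \<Rightarrow> ('n \<Rightarrow> nat) \<Rightarrow> real ^ 'n" where
  "point e a = (\<chi> i. real (a i) / real (p ^ e))"

lemma point_rescale: "point e a = point (k + e) (\<lambda>i. p ^ k * a i)"
  using char by (simp add: point_def vec_eq_iff power_add)

lemma point_eq_iff: "point e a = point e' a' \<longleftrightarrow> (\<forall>i. p ^ e' * a i = p ^ e * a' i)"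
proof -
  have "real (a i) / real (p ^ e) = real (a' i) / real (p ^ e') \<longleftrightarrow> p ^ e' * a i = p ^ e * a' i" for i
  proof -
    have "real (a i) / real (p ^ e) = real (a' i) / real (p ^ e') \<longleftrightarrow>
        real (p ^ e' * a i) = real (p ^ e * a' i)"
      using char(2) by (simp add: field_simps)
    thus ?thesis by (simp only: of_nat_eq_iff)
  qed
  thus ?thesis by (simp add: point_def vec_eq_iff)
qed

text \<open>Two presentations of the same point become equal after rescaling each by the denominator of
  the other, and rescaling multiplies the gap by the scale.\<close>

lemma cell_gap_point:
  assumes "\<And>i. a i \<le> p ^ e"
  shows "cell_gap p l (F, G, H) (point e a) = of_int (gap e a) / real (p ^ e)"
  unfolding cell_gap_def Let_def prod.case point_def[symmetric]
proof (rule the_equality)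
  show "\<forall>e' a'. (\<forall>i. a' i \<le> p ^ e') \<and> point e a = point e' a' \<longrightarrow>
      of_int (gap e a) / real (p ^ e) = 1 / real (p ^ e') *
        of_int (syzygy_gap (F ^ p ^ e') (G ^ p ^ e') (H ^ p ^ e' * (\<Prod>i\<in>UNIV. l i ^ a' i)))"
  proof (intro allI impI, elim conjE)
    fix e' a' assume "point e a = point e' a'"
    hence "(\<lambda>i. p ^ e' * a i) = (\<lambda>i. p ^ e * a' i)" by (simp add: point_eq_iff)
    hence "int (p ^ e') * gap e a = int (p ^ e) * gap e' a'"
      using gap_scale[of e' e a] gap_scale[of e e' a'] by (simp only: add.commute)
    hence "real_of_int (int (p ^ e') * gap e a) = real_of_int (int (p ^ e) * gap e' a')" by (rule arg_cong)
    hence "real (p ^ e') * of_int (gap e a) = real (p ^ e) * of_int (gap e' a')" by simp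
    thus "of_int (gap e a) / real (p ^ e) = 1 / real (p ^ e') *
        of_int (syzygy_gap (F ^ p ^ e') (G ^ p ^ e') (H ^ p ^ e' * (\<Prod>i\<in>UNIV. l i ^ a' i)))"
      using char(2) unfolding gap_def[symmetric] by (simp add: field_simps)
  qed
next
  fix r :: real
  assume "\<forall>e' a'. (\<forall>i. a' i \<le> p ^ e') \<and> point e a = point e' a' \<longrightarrow>
      r = 1 / real (p ^ e') *
        of_int (syzygy_gap (F ^ p ^ e') (G ^ p ^ e') (H ^ p ^ e' * (\<Prod>i\<in>UNIV. l i ^ a' i)))"
  from this[rule_format, of a e] assms show "r = of_int (gap e a) / real (p ^ e)"
    by (simp add: gap_def)
qed

lemma point_in_cube:
  assumes "\<And>i. a i \<le> p ^ e"
  shows "point e a \<in> padic_cube p"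
proof -
  have "real (a i) / real (p ^ e) \<in> padic_unit_interval p" for i
  proof -
    have "real (a i) \<le> real (p ^ e)" using assms[of i] by (simp only: of_nat_le_iff)
    hence "real (a i) / real (p ^ e) \<le> 1" using char(2) by simp
    moreover have "\<exists>b k. real (a i) / real (p ^ e) = of_int b / real (p ^ k)"
      by (intro exI[of _ "int (a i)"] exI[of _ e]) simp
    ultimately show ?thesis by (auto simp: padic_unit_interval_def)
  qed
  thus ?thesis by (simp add: padic_cube_def point_def)
qed

text \<open>The product of all denominators \<open>p ^ k i\<close> serves as the common denominator \<open>p ^ e\<close>.\<close>

lemma cube_point_exists:
  assumes "t \<in> padic_cube p"
  shows "\<exists>e a. (\<forall>i. a i \<le> p ^ e) \<and> t = point e a"
proof -
  have "\<forall>i. \<exists>b k. t $ i = real_of_int b / real (p ^ k)"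
    using assms by (auto simp: padic_cube_def padic_unit_interval_def)
  then obtain b k where bk: "\<And>i. t $ i = real_of_int (b i) / real (p ^ k i)" by metis
  define e where "e = (\<Sum>i\<in>UNIV. k i)"
  define a where "a i = nat (b i) * p ^ (e - k i)" for i
  have q: "real (p ^ n) > 0" for n using char(2) by simp
  have 01: "0 \<le> t $ i" "t $ i \<le> 1" for i
    using assms by (auto simp: padic_cube_def padic_unit_interval_def)
  have t: "t $ i = real (a i) / real (p ^ e)" for i
  proof -
    have "k i \<le> e" unfolding e_def by (rule member_le_sum) auto
    hence e: "p ^ e = p ^ k i * p ^ (e - k i)" by (simp flip: power_add)
    have "0 \<le> t $ i * real (p ^ k i)" using 01(1)[of i] q[of "k i"] by (intro mult_nonneg_nonneg) auto
    also have "t $ i * real (p ^ k i) = real_of_int (b i)" using q[of "k i"] by (simp add: bk)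
    finally have "b i \<ge> 0" by simp
    thus ?thesis using q[of "e - k i"] char(2) by (simp add: a_def bk e)
  qed
  hence "t = point e a" by (simp add: point_def vec_eq_iff)
  moreover have "a i \<le> p ^ e" for i
  proof -
    have "real (a i) \<le> real (p ^ e)" using 01(2)[of i] q[of e] unfolding t by simp
    thus ?thesis by (simp only: of_nat_le_iff)
  qed
  ultimately show ?thesis by blast
qed

lemma taxicab_point: "taxicab (point e a) (point e b) = of_int (lattice_dist a b) / real (p ^ e)"
  unfolding taxicab_def lattice_dist_def of_int_sum sum_divide_distrib
proof (rule sum.cong)
  fix i
  have "\<bar>point e a $ i - point e b $ i\<bar> = \<bar>(real (a i) - real (b i)) / real (p ^ e)\<bar>"
    by (simp add: point_def diff_divide_distrib)
  also have "\<dots> = of_int \<bar>int (a i) - int (b i)\<bar> / real (p ^ e)" by simp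
  finally show "\<bar>point e a $ i - point e b $ i\<bar> = of_int \<bar>int (a i) - int (b i)\<bar> / real (p ^ e)" .
qed simp

abbreviation "\<delta> \<equiv> cell_gap p l (F, G, H)"

lemma cell_gap_lipschitz:
  assumes "t \<in> padic_cube p" "z \<in> padic_cube p"
  shows "\<delta> t - \<delta> z \<le> taxicab t z"
proof -
  obtain e a e' b where a: "\<And>i. a i \<le> p ^ e" "t = point e a" and b: "\<And>i. b i \<le> p ^ e'" "z = point e' b"
    using cube_point_exists[OF assms(1)] cube_point_exists[OF assms(2)] by blast
  define A B where "A = (\<lambda>i. p ^ e' * a i)" and "B = (\<lambda>i. p ^ e * b i)"
  have t: "t = point (e + e') A" and z: "z = point (e + e') B"
    using point_rescale[of e a e'] point_rescale[of e' b e] by (simp_all add: a b A_def B_def add.commute)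
  have AB: "A i \<le> p ^ (e + e')" "B i \<le> p ^ (e + e')" for i
    using a(1)[of i] b(1)[of i] by (simp_all add: A_def B_def power_add mult.commute)
  have "\<delta> t - \<delta> z = of_int (gap (e + e') A - gap (e + e') B) / real (p ^ (e + e'))"
    unfolding t z using AB by (simp add: cell_gap_point diff_divide_distrib)
  also have "\<dots> \<le> of_int (lattice_dist A B) / real (p ^ (e + e'))"
    by (intro divide_right_mono) (simp_all only: of_int_le_iff gap_lipschitz of_nat_0_le_iff)
  also have "\<dots> = taxicab t z" by (simp add: t z taxicab_point)
  finally show ?thesis .
qed

lemma cell_gap_from_minimal_corner:
  assumes u: "minimal_corner u" and t: "t \<in> padic_cube p"
  shows "\<delta> t = \<delta> (point 0 u) + taxicab t (point 0 u)"
proof -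
  obtain e a where a: "\<And>i. a i \<le> p ^ e" "t = point e a" using cube_point_exists[OF t] by blast
  have u01: "u i \<le> p ^ 0" for i using u by (auto simp: minimal_corner_def dest: spec[of _ i])
  have q: "real (p ^ e) > 0" using char(2) by simp
  have "\<delta> t = (real (p ^ e) * of_int (gap 0 u) + of_int (lattice_dist a (\<lambda>i. p ^ e * u i))) / real (p ^ e)"
    unfolding a(2) cell_gap_point[OF a(1)] gap_from_minimal_corner[OF u a(1)] by simp
  also have "\<dots> = of_int (gap 0 u) + of_int (lattice_dist a (\<lambda>i. p ^ e * u i)) / real (p ^ e)"
    using q by (simp add: add_divide_distrib)
  also have "of_int (gap 0 u) = \<delta> (point 0 u)" using cell_gap_point[OF u01] by simp
  also have "of_int (lattice_dist a (\<lambda>i. p ^ e * u i)) / real (p ^ e) = taxicab t (point 0 u)"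
    using point_rescale[of 0 u e] by (simp add: a(2) taxicab_point)
  finally show ?thesis .
qed

lemma zero_or_minimal_corner:
  assumes "t \<in> padic_cube p"
  shows "(\<exists>z\<in>padic_cube p. \<delta> z = 0 \<and> taxicab t z \<le> \<delta> t) \<or> (\<exists>u. minimal_corner u)"
proof -
  obtain e a where a: "\<And>i. a i \<le> p ^ e" "t = point e a" using cube_point_exists[OF assms] by blast
  show ?thesis
  proof (cases "\<exists>u. minimal_corner u")
    case False
    then obtain z where z: "\<And>i. z i \<le> p ^ e" "gap e z = 0" "lattice_dist a z \<le> gap e a"
      using descent[of a e] a(1) by blast
    have "taxicab t (point e z) \<le> \<delta> t"
      unfolding a(2) taxicab_point cell_gap_point[OF a(1)]
      by (intro divide_right_mono) (simp_all only: of_int_le_iff z(3) of_nat_0_le_iff)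
    moreover have "\<delta> (point e z) = 0" by (simp add: cell_gap_point z)
    ultimately show ?thesis using point_in_cube[of z e] z(1) by blast
  qed simp
qed

lemma cell_gap_pos_of_minimal_corner:
  assumes "minimal_corner u"
  shows "\<delta> (point 0 u) > 0"
proof -
  have "u i \<le> p ^ 0" for i using assms by (auto simp: minimal_corner_def dest: spec[of _ i])
  thus ?thesis using assms cell_gap_point[of u 0] by (simp add: minimal_corner_def)
qed

end

lemma taxicab_nonneg: "taxicab t z \<ge> 0"
  unfolding taxicab_def by (rule sum_nonneg) auto

lemma taxicab_pos: "t \<noteq> z \<Longrightarrow> taxicab t z > 0"
proof -
  assume "t \<noteq> z"
  then obtain i where "t $ i \<noteq> z $ i" by (auto simp: vec_eq_iff)
  thus ?thesis unfolding taxicab_def by (intro sum_pos2[of _ i]) auto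
qed

lemma corners_subset_cube: "corners \<subseteq> padic_cube p"
proof -
  have "of_int a \<in> padic_unit_interval p" if "a \<in> {0, 1}" for a
  proof -
    have "\<exists>b k. real_of_int a = of_int b / real (p ^ k)" by (intro exI[of _ a] exI[of _ 0]) simp
    thus ?thesis using that by (auto simp: padic_unit_interval_def)
  qed
  from this[of 0] this[of 1] have "0 \<in> padic_unit_interval p" "1 \<in> padic_unit_interval p" by simp_all
  hence "x \<in> padic_unit_interval p" if "x \<in> {0, 1}" for x using that by auto
  thus ?thesis unfolding corners_def padic_cube_def by blast
qed

text \<open>On the cube the distance to a corner is \<open>t $ i\<close> or \<open>1 - t $ i\<close> in each coordinate, according
  to whether \<open>u $ i\<close> is \<open>0\<close> or \<open>1\<close>.\<close>

lemma taxicab_to_corner_affine: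
  fixes u :: "real ^ 'n::finite"
  assumes "u \<in> corners" "t \<in> padic_cube p"
  shows "taxicab t u = (\<Sum>i\<in>UNIV. u $ i) + (\<Sum>i\<in>UNIV. (1 - 2 * u $ i) * t $ i)"
  unfolding taxicab_def sum.distrib[symmetric]
proof (rule sum.cong)
  fix i
  have "u $ i = 0 \<or> u $ i = 1" "0 \<le> t $ i" "t $ i \<le> 1"
    using assms by (auto simp: corners_def padic_cube_def padic_unit_interval_def)
  thus "\<bar>t $ i - u $ i\<bar> = u $ i + (1 - 2 * u $ i) * t $ i" by auto
qed simp

theorem theorem1:
  fixes p :: nat
    and l :: "'n::finite \<Rightarrow> 'k::field poly poly"
    and C :: "'k poly poly \<times> 'k poly poly \<times> 'k poly poly"
    and \<delta> :: "real ^ 'n \<Rightarrow> real"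
    and Z :: "(real ^ 'n) set"
  assumes char: "CHAR('k) = p" "p > 0"
    and forms: "\<And>i. linear_form (l i)"
    and pairwise_coprime: "\<And>i j. i \<noteq> j \<Longrightarrow> coprime (l i) (l j)"
    and cell: "is_cell l C"
  defines "\<delta> \<equiv> cell_gap p l C"
    and "Z \<equiv> {z \<in> padic_cube p. cell_gap p l C z = 0}"
  shows "(Z = {} \<longrightarrow>
      (\<exists>u\<in>corners.
         \<delta> u > 0 \<and>
         (\<forall>v\<in>corners. adjacent u v \<longrightarrow> \<delta> v > \<delta> u) \<and>
         (\<forall>t\<in>padic_cube p. \<delta> u \<le> \<delta> t) \<and>
         (\<forall>t\<in>padic_cube p. \<delta> t = \<delta> u + taxicab t u)) \<and>
      (\<exists>(c :: real) (b :: 'n \<Rightarrow> real). \<forall>t\<in>padic_cube p. \<delta> t = c + (\<Sum>i\<in>UNIV. b i * t $ i))) \<and>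
    (Z \<noteq> {} \<longrightarrow>
      (\<forall>t\<in>padic_cube p. \<delta> t = (INF z\<in>Z. taxicab t z)))"
proof -
  obtain F G H where C: "C = (F, G, H)" by (metis prod_cases3)
  obtain f g h where "homogeneous_of f F" "homogeneous_of g G" "homogeneous_of h H"
    using cell by (auto simp: is_cell_def C homogeneous_def)
  with cell have "three_forms F G H f g h" by unfold_locales (auto simp: is_cell_def C)
  then interpret cell p F G H f g h l
    using cell char forms pairwise_coprime
    by unfold_locales (auto simp: is_cell_def C no_common_factor_def three_forms_def)
  have \<delta>: "\<delta> = cell_gap p l (F, G, H)" and Z: "Z = {z \<in> padic_cube p. \<delta> z = 0}"
    by (simp_all add: \<delta>_def Z_def C)
  have corner_case: "\<exists>u\<in>corners. \<delta> u > 0 \<and> (\<forall>t\<in>padic_cube p. \<delta> t = \<delta> u + taxicab t u)"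
    if u: "minimal_corner u" for u
  proof
    show "point 0 u \<in> corners" using u by (force simp: minimal_corner_def corners_def point_def)
    show "\<delta> (point 0 u) > 0 \<and> (\<forall>t\<in>padic_cube p. \<delta> t = \<delta> (point 0 u) + taxicab t (point 0 u))"
      using cell_gap_from_minimal_corner[OF u] cell_gap_pos_of_minimal_corner[OF u] by (simp add: \<delta>)
  qed
  show ?thesis
  proof (intro conjI impI)
    assume "Z = {}"
    moreover have "(0 :: real ^ 'n) \<in> padic_cube p" using corners_subset_cube[of p] by (auto simp: corners_def)
    ultimately obtain u0 where "minimal_corner u0"
      using zero_or_minimal_corner[of 0] by (auto simp: Z \<delta>)
    from corner_case[OF this] obtain u where u: "u \<in> corners" "\<delta> u > 0"
      and eq: "\<And>t. t \<in> padic_cube p \<Longrightarrow> \<delta> t = \<delta> u + taxicab t u" by blast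
    have "\<delta> v > \<delta> u" if "v \<in> corners" "adjacent u v" for v
    proof -
      have "v \<noteq> u" "v \<in> padic_cube p"
        using that corners_subset_cube by (auto simp: adjacent_def)
      thus ?thesis using eq[of v] taxicab_pos[of v u] by simp
    qed
    moreover have "\<delta> u \<le> \<delta> t" if "t \<in> padic_cube p" for t
      using eq[OF that] taxicab_nonneg[of t u] by simp
    ultimately show "\<exists>u\<in>corners. \<delta> u > 0 \<and> (\<forall>v\<in>corners. adjacent u v \<longrightarrow> \<delta> v > \<delta> u) \<and>
         (\<forall>t\<in>padic_cube p. \<delta> u \<le> \<delta> t) \<and> (\<forall>t\<in>padic_cube p. \<delta> t = \<delta> u + taxicab t u)"
      using u eq by blast
    have "\<delta> t = (\<delta> u + (\<Sum>i\<in>UNIV. u $ i)) + (\<Sum>i\<in>UNIV. (1 - 2 * u $ i) * t $ i)"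
      if "t \<in> padic_cube p" for t
      using eq[OF that] taxicab_to_corner_affine[OF u(1) that] by simp
    thus "\<exists>(c :: real) (b :: 'n \<Rightarrow> real). \<forall>t\<in>padic_cube p. \<delta> t = c + (\<Sum>i\<in>UNIV. b i * t $ i)"
      by (intro exI[of _ "\<delta> u + (\<Sum>i\<in>UNIV. u $ i)"] exI[of _ "\<lambda>i. 1 - 2 * u $ i"]) blast
  next
    assume "Z \<noteq> {}"
    have no_corner: "\<not> minimal_corner u" for u
    proof
      assume "minimal_corner u"
      from corner_case[OF this] obtain v where "\<delta> v > 0"
        "\<And>t. t \<in> padic_cube p \<Longrightarrow> \<delta> t = \<delta> v + taxicab t v" by blast
      hence "\<delta> t \<noteq> 0" if "t \<in> padic_cube p" for t using that taxicab_nonneg[of t v] by fastforce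
      thus False using \<open>Z \<noteq> {}\<close> by (auto simp: Z)
    qed
    show "\<forall>t\<in>padic_cube p. \<delta> t = (INF z\<in>Z. taxicab t z)"
    proof
      fix t :: "real ^ 'n" assume t: "t \<in> padic_cube p"
      have le: "\<delta> t \<le> taxicab t z" if "z \<in> Z" for z
        using cell_gap_lipschitz[OF t, of z] that by (auto simp: Z \<delta>)
      obtain z where "z \<in> Z" "taxicab t z \<le> \<delta> t"
        using zero_or_minimal_corner[OF t] no_corner by (auto simp: Z \<delta>)
      with le have "\<delta> t \<in> (\<lambda>z. taxicab t z) ` Z" by (metis antisym imageI)
      hence "(INF z\<in>Z. taxicab t z) = \<delta> t"
        by (rule cInf_eq_minimum) (use le in auto)
      thus "\<delta> t = (INF z\<in>Z. taxicab t z)" by simp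
    qed
  qed
qed

end
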